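(* Let $\vec{v}$ be one of the vectors of the canonical basis $\{(1,0,0),(0,1,0),(0,0,1)\}$ of $\mathbb{R}^3$. Planes and grim reapers are the only translating solitons with respect to $\vec{v}$ of homothetical type. That is: let $I,J\subset\mathbb{R}$ be open intervals and let $f:I\to\mathbb{R}$, $g:J\to\mathbb{R}$ be smooth functions such that the graph $z=f(x)g(y)$, $(x,y)\in I\times J$, is a translating soliton with respect to $\vec{v}$. Then this surface is (part of) a plane or a grim reaper.
   Context: $\mathbb{R}^3$ is Euclidean space with canonical coordinates $(x,y,z)$ and standard inner product $\langle\cdot,\cdot\rangle$. A translating soliton with respect to a non-zero vector $\vec{v}\in\mathbb{R}^3$ is a smooth surface $M\subset\mathbb{R}^3$ whose mean curvature $H$ satisfies $H(p)=\langle N(p),\vec{v}\rangle$ for all $p\in M$, where $N$ is the unit normal vector field on $M$. The convention is that $H$ is the average of the two principal curvatures with respect to $N$ (half the trace of the shape operator); thus for a graph $z=u(x,y)$ with $\vec{v}=(v_1,v_2,v_3)$ the equation reads $$(1+u_y^2)u_{xx}-2u_xu_yu_{xy}+(1+u_x^2)u_{yy}=2(1+u_x^2+u_y^2)(-v_1u_x-v_2u_y+v_3).$$ A surface is of homothetical type if it is a graph $z=f(x)g(y)$ with $f,g$ smooth functions of one variable. A cylindrical surface is a surface invariant under a one-parameter group of translations (i.e. ruled by parallel straight lines). A grim reaper (with respect to $\vec{v}$) is a non-planar cylindrical surface that is a translating soliton with respect to $\vec{v}$; its rulings are necessarily not parallel to $\vec{v}$. *)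

theory Defs
  imports "HOL-Analysis.Analysis"
begin

text \<open>Meant for open \<open>S\<close>, where \<open>frechet_derivative f (at x)\<close> is the derivative.\<close>

fun Ck_on :: "nat \<Rightarrow> 'a::real_normed_vector set \<Rightarrow> ('a \<Rightarrow> 'b::real_normed_vector) \<Rightarrow> bool" where
  "Ck_on 0 S f \<longleftrightarrow> continuous_on S f"
| "Ck_on (Suc k) S f \<longleftrightarrow>
     (\<forall>x\<in>S. f differentiable (at x)) \<and>
     (\<forall>v. Ck_on k S (\<lambda>x. frechet_derivative f (at x) v))"

definition smooth_on :: "'a::real_normed_vector set \<Rightarrow> ('a \<Rightarrow> 'b::real_normed_vector) \<Rightarrow> bool" where
  "smooth_on S f \<longleftrightarrow> (\<forall>k. Ck_on k S f)"

definition smooth_surface :: "(real^3) set \<Rightarrow> bool" where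
  "smooth_surface M \<longleftrightarrow>
     (\<forall>p\<in>M. \<exists>V U (X :: real \<times> real \<Rightarrow> real^3) Y.
        open V \<and> p \<in> V \<and> open U \<and> smooth_on U X \<and>
        homeomorphism U (M \<inter> V) X Y \<and>
        (\<forall>q\<in>U. inj (frechet_derivative X (at q))))"

definition tangent_plane :: "(real^3) set \<Rightarrow> real^3 \<Rightarrow> (real^3) set" where
  "tangent_plane M p =
     {w. \<exists>\<epsilon>>0. \<exists>\<gamma>. smooth_on {-\<epsilon><..<\<epsilon>} \<gamma> \<and> \<gamma> ` {-\<epsilon><..<\<epsilon>} \<subseteq> M \<and>
           \<gamma> 0 = p \<and> (\<gamma> has_vector_derivative w) (at 0)}"

text \<open>
  On a smooth surface any continuous unit normal field is smooth, since locally it is, up to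
  sign, the normalized cross product of the coordinate tangent vectors of a chart.
  Differentiability within the surface is therefore no weaker than smoothness here.
\<close>

definition unit_normal_field :: "(real^3) set \<Rightarrow> (real^3 \<Rightarrow> real^3) \<Rightarrow> bool" where
  "unit_normal_field M N \<longleftrightarrow>
     N differentiable_on M \<and>
     (\<forall>p\<in>M. norm (N p) = 1 \<and> (\<forall>w\<in>tangent_plane M p. N p \<bullet> w = 0))"

text \<open>
  The derivative of \<open>N\<close> at \<open>p\<close> within \<open>M\<close> is determined only on vectors tangent to \<open>M\<close>, so
  the following is meaningful only for \<open>w \<in> tangent_plane M p\<close>, where it is \<open>- dN\<^sub>p(w)\<close>.
\<close>

definition shape_operator :: "(real^3) set \<Rightarrow> (real^3 \<Rightarrow> real^3) \<Rightarrow> real^3 \<Rightarrow> real^3 \<Rightarrow> real^3" where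
  "shape_operator M N p w = - frechet_derivative N (at p within M) w"

text \<open>
  Half the trace of the shape operator on the tangent plane, computed in an orthonormal
  basis of the plane (the value does not depend on the basis).
\<close>

definition mean_curvature :: "(real^3) set \<Rightarrow> (real^3 \<Rightarrow> real^3) \<Rightarrow> real^3 \<Rightarrow> real" where
  "mean_curvature M N p =
     (THE h. \<exists>e\<^sub>1\<in>tangent_plane M p. \<exists>e\<^sub>2\<in>tangent_plane M p.
        norm e\<^sub>1 = 1 \<and> norm e\<^sub>2 = 1 \<and> e\<^sub>1 \<bullet> e\<^sub>2 = 0 \<and>
        h = (shape_operator M N p e\<^sub>1 \<bullet> e\<^sub>1 + shape_operator M N p e\<^sub>2 \<bullet> e\<^sub>2) / 2)"

definition translating_soliton :: "real^3 \<Rightarrow> (real^3) set \<Rightarrow> bool" where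
  "translating_soliton v M \<longleftrightarrow>
     smooth_surface M \<and>
     (\<exists>N. unit_normal_field M N \<and> (\<forall>p\<in>M. mean_curvature M N p = N p \<bullet> v))"

definition is_plane :: "(real^3) set \<Rightarrow> bool" where
  "is_plane P \<longleftrightarrow> (\<exists>a b. a \<noteq> 0 \<and> P = {p. a \<bullet> p = b})"

definition cylindrical :: "(real^3) set \<Rightarrow> bool" where
  "cylindrical M \<longleftrightarrow> (\<exists>w. w \<noteq> 0 \<and> (\<forall>t. (\<lambda>p. p + t *\<^sub>R w) ` M = M))"

text \<open>
  Connectedness excludes disjoint unions, such as two parallel planes containing the
  direction \<open>v\<close>, which would otherwise count as non-planar.
\<close>

definition grim_reaper :: "real^3 \<Rightarrow> (real^3) set \<Rightarrow> bool" where
  "grim_reaper v G \<longleftrightarrow>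
     translating_soliton v G \<and> connected G \<and> cylindrical G \<and>
     \<not> (\<exists>P. is_plane P \<and> G \<subseteq> P)"

definition homothetical_graph :: "real set \<Rightarrow> real set \<Rightarrow> (real \<Rightarrow> real) \<Rightarrow> (real \<Rightarrow> real) \<Rightarrow> (real^3) set" where
  "homothetical_graph I J f g = {vector [x, y, f x * g y] | x y. x \<in> I \<and> y \<in> J}"

end

theory Submission
  imports Defs
begin

text \<open>
  For a unit normal field \<open>N\<close> along the graph \<open>X\<close>, differentiating \<open>N \<bullet> X\<^sub>x = 0\<close> and
  \<open>N \<bullet> X\<^sub>y = 0\<close> expresses the mean curvature through \<open>N $ 3\<close> and the second derivatives, whatever
  the orientation of \<open>N\<close>; this turns the soliton condition into its partial differential equation.

  If neither \<open>f\<close> nor \<open>g\<close> is constant, the equation is contradictory. For vertical \<open>v\<close> it is linear in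
  \<open>(f'', f'\<^sup>2)\<close> for each \<open>y\<close>, with coefficients polynomial in \<open>f\<close>; three values of \<open>y\<close> give a
  determinant that vanishes identically in \<open>f\<close>, but at \<open>0\<close> it is a Vandermonde determinant of values
  of \<open>g\<close>. For \<open>v = (1, 0, 0)\<close>, where \<open>f, f', g, g'\<close> do not vanish, dividing by \<open>f g\<close> gives
  \<open>\<rho> + m (t \<rho> - 2 Q) + k Q + P t + K = 0\<close>, with \<open>t = g\<^sup>2\<close>, \<open>Q = g'\<^sup>2\<close>, \<open>\<rho> = g'' / g\<close>, \<open>m = f'\<^sup>2\<close>,
  \<open>k = f (f'' + 2 f')\<close>, \<open>P = 2 f'\<^sup>3 / f\<close> and \<open>K = k / f\<^sup>2\<close>. Either \<open>Q\<close> is an affine function of \<open>t\<close>, or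
  three values of \<open>y\<close> solve for \<open>k, P, K\<close> as affine functions of \<open>m\<close>. Both alternatives
  lead to polynomial identities that cannot hold.

  If \<open>f\<close> or \<open>g\<close> is constant, extending that factor to the whole line gives a cylinder that satisfies
  the same equation, hence a grim reaper unless it is planar.
\<close>

section \<open>Calculus of \<open>Ck_on\<close> functions\<close>

text \<open>Derivatives at a point of an open set depend only on nearby values, so agreement on
  \<open>S\<close> passes to every order of differentiation.\<close>

lemma Ck_on_cong:
  assumes "open S" "Ck_on k S f" "\<And>x. x \<in> S \<Longrightarrow> f x = g x"
  shows "Ck_on k S g"
  using assms(2,3)
proof (induction k arbitrary: f g)
  case 0
  then show ?case by (simp cong: continuous_on_cong)
next
  case (Suc k)
  have D: "(g has_derivative frechet_derivative f (at x)) (at x)" if "x \<in> S" for x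
    using Suc.prems that \<open>open S\<close>
    by (auto simp: frechet_derivative_works intro: has_derivative_transform_within_open)
  have "frechet_derivative f (at x) v = frechet_derivative g (at x) v" if "x \<in> S" for x v
    using frechet_derivative_at[OF D[OF that]] by simp
  then have "Ck_on k S (\<lambda>x. frechet_derivative g (at x) v)" for v
    using Suc.IH[of "\<lambda>x. frechet_derivative f (at x) v" "\<lambda>x. frechet_derivative g (at x) v"]
      Suc.prems by auto
  then show ?case
    using D by (auto simp: differentiable_def)
qed

text \<open>By uniqueness of the derivative, an explicit family \<open>D\<close> may replace the
  \<open>frechet_derivative\<close> of the definition. The closure properties below are proved in
  this way.\<close>

lemma Ck_on_SucI:
  assumes "open S" and D: "\<And>x. x \<in> S \<Longrightarrow> (f has_derivative D x) (at x)"
    and k: "\<And>v. Ck_on k S (\<lambda>x. D x v)"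
  shows "Ck_on (Suc k) S f"
proof -
  have "D x = frechet_derivative f (at x)" if "x \<in> S" for x
    using frechet_derivative_at[OF D[OF that]] .
  then have "Ck_on k S (\<lambda>x. frechet_derivative f (at x) v)" for v
    using Ck_on_cong[OF \<open>open S\<close> k[of v], of "\<lambda>x. frechet_derivative f (at x) v"] by auto
  then show ?thesis
    using D by (auto simp: differentiable_def)
qed

lemma Ck_on_lower: "Ck_on (Suc k) S f \<Longrightarrow> Ck_on k S f"
proof (induction k arbitrary: f)
  case 0
  then show ?case
    by (auto intro!: continuous_at_imp_continuous_on differentiable_imp_continuous_within)
qed auto

lemma Ck_on_has_derivative:
  "Ck_on (Suc k) S f \<Longrightarrow> x \<in> S \<Longrightarrow> (f has_derivative frechet_derivative f (at x)) (at x)"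
  by (auto simp: frechet_derivative_works)

lemma Ck_on_const: "open S \<Longrightarrow> Ck_on k S (\<lambda>x. c)"
proof (induction k arbitrary: c)
  case (Suc k)
  show ?case
    by (rule Ck_on_SucI[where D = "\<lambda>_ _. 0"]) (simp_all add: Suc)
qed auto

lemma Ck_on_linear:
  assumes "open S" "bounded_linear L"
  shows "Ck_on k S L"
proof (cases k)
  case 0
  then show ?thesis using assms by (simp add: linear_continuous_on)
next
  case (Suc n)
  show ?thesis
    unfolding Suc
    by (rule Ck_on_SucI[where D = "\<lambda>_. L"])
      (simp_all add: assms Ck_on_const bounded_linear_imp_has_derivative)
qed

lemma Ck_on_add:
  assumes "open S" "Ck_on k S f" "Ck_on k S g"
  shows "Ck_on k S (\<lambda>x. f x + g x)"
  using assms(2,3)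
proof (induction k arbitrary: f g)
  case (Suc k)
  show ?case
  proof (rule Ck_on_SucI[OF \<open>open S\<close>])
    show "((\<lambda>x. f x + g x) has_derivative
        (\<lambda>v. frechet_derivative f (at x) v + frechet_derivative g (at x) v)) (at x)" if "x \<in> S" for x
      using Suc.prems that by (intro has_derivative_add Ck_on_has_derivative[of k S])
  qed (use Suc in auto)
qed (auto intro!: continuous_on_add)

lemma Ck_on_scaleR:
  fixes f :: "'a::real_normed_vector \<Rightarrow> real"
  assumes "open S" "Ck_on k S f" "Ck_on k S g"
  shows "Ck_on k S (\<lambda>x. f x *\<^sub>R g x)"
  using assms(2,3)
proof (induction k arbitrary: f g)
  case (Suc k)
  show ?case
  proof (rule Ck_on_SucI[OF \<open>open S\<close>])
    show "((\<lambda>x. f x *\<^sub>R g x) has_derivative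
        (\<lambda>v. f x *\<^sub>R frechet_derivative g (at x) v + frechet_derivative f (at x) v *\<^sub>R g x)) (at x)"
      if "x \<in> S" for x
      using Suc.prems that by (intro has_derivative_scaleR Ck_on_has_derivative[of k S])
    show "Ck_on k S (\<lambda>x. f x *\<^sub>R frechet_derivative g (at x) v + frechet_derivative f (at x) v *\<^sub>R g x)" for v
      using Suc by (intro Ck_on_add[OF \<open>open S\<close>] Suc.IH) (auto intro: Ck_on_lower)
  qed
qed (auto intro!: continuous_on_add continuous_on_scaleR)

lemma Ck_on_mult:
  fixes f g :: "'a::real_normed_vector \<Rightarrow> real"
  shows "open S \<Longrightarrow> Ck_on k S f \<Longrightarrow> Ck_on k S g \<Longrightarrow> Ck_on k S (\<lambda>x. f x * g x)"
  using Ck_on_scaleR[of S k f g] by simp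

text \<open>Affine inner maps keep the induction simple: each derivative of the composite is a
  derivative of \<open>f\<close> in the fixed direction \<open>L v\<close>, composed with the same
  affine map.\<close>

lemma Ck_on_compose_affine:
  assumes "open S" "bounded_linear L" "Ck_on k S f" and T: "open T" "\<And>x. x \<in> T \<Longrightarrow> c + L x \<in> S"
  shows "Ck_on k T (\<lambda>x. f (c + L x))"
  using assms(3)
proof (induction k arbitrary: f)
  case 0
  then show ?case
    using T continuous_on_compose2[of S f T "\<lambda>x. c + L x"]
    by (auto simp: continuous_on_add linear_continuous_on assms(2))
next
  case (Suc k)
  show ?case
  proof (rule Ck_on_SucI[OF T(1), where D = "\<lambda>x v. frechet_derivative f (at (c + L x)) (L v)"])
    fix x assume "x \<in> T"
    have "((\<lambda>x. c + L x) has_derivative L) (at x)"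
      using assms(2) by (auto intro!: derivative_eq_intros bounded_linear_imp_has_derivative)
    from has_derivative_compose[OF this] Ck_on_has_derivative[OF Suc.prems T(2)[OF \<open>x \<in> T\<close>]]
    show "((\<lambda>x. f (c + L x)) has_derivative (\<lambda>v. frechet_derivative f (at (c + L x)) (L v))) (at x)"
      by blast
  qed (use Suc in auto)
qed

section \<open>Ordinary derivatives and coordinates in three-space\<close>

lemma smooth_on_imp_deriv:
  fixes f :: "real \<Rightarrow> real"
  assumes "open S" "smooth_on S f" "x \<in> S"
  shows "(f has_real_derivative deriv f x) (at x)"
    and "(deriv f has_real_derivative deriv (deriv f) x) (at x)"
proof -
  have k: "Ck_on (Suc (Suc 0)) S f"
    using assms by (auto simp: smooth_on_def)
  have d: "f differentiable at y" if "y \<in> S" for y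
    using k that by auto
  then have d': "(f has_real_derivative deriv f y) (at y)" if "y \<in> S" for y
    using that by (simp add: DERIV_deriv_iff_real_differentiable)
  have "deriv f y = frechet_derivative f (at y) 1" if "y \<in> S" for y
    using frechet_derivative_at[OF d'[OF that, unfolded has_field_derivative_def]]
    by (metis mult.right_neutral)
  moreover have "(\<lambda>y. frechet_derivative f (at y) 1) differentiable at x"
    using k \<open>x \<in> S\<close> by auto
  ultimately have "deriv f differentiable at x"
    unfolding differentiable_def
    using assms(1,3) has_derivative_transform_within_open[where f = "\<lambda>y. frechet_derivative f (at y) 1" and g = "deriv f"]
    by (metis (no_types, lifting))
  then show "(deriv f has_real_derivative deriv (deriv f) x) (at x)"
    by (simp add: DERIV_deriv_iff_real_differentiable)
  show "(f has_real_derivative deriv f x) (at x)"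
    using d' assms by auto
qed

lemma vector_3_eq_axis:
  "(vector [a, b, c] :: real^3) = a *\<^sub>R axis 1 1 + b *\<^sub>R axis 2 1 + c *\<^sub>R axis 3 1"
  by (simp add: vec_eq_iff forall_3 axis_def)

lemma inner_vector_3: "(w :: real^3) \<bullet> vector [a, b, c] = w $ 1 * a + w $ 2 * b + w $ 3 * c"
  by (simp add: inner_vec_def sum_3)

lemma smooth_on_vector_3:
  fixes a b c :: "'a::real_normed_vector \<Rightarrow> real"
  assumes "open S" "smooth_on S a" "smooth_on S b" "smooth_on S c"
  shows "smooth_on S (\<lambda>x. vector [a x, b x, c x] :: real^3)"
  unfolding smooth_on_def vector_3_eq_axis
  using assms by (auto simp: smooth_on_def intro!: Ck_on_add Ck_on_scaleR Ck_on_const)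

lemma has_derivative_vector_3:
  assumes "(a has_derivative a') F" "(b has_derivative b') F" "(c has_derivative c') F"
  shows "((\<lambda>x. vector [a x, b x, c x] :: real^3) has_derivative (\<lambda>v. vector [a' v, b' v, c' v])) F"
  unfolding vector_3_eq_axis using assms by (auto intro!: derivative_eq_intros)

lemma has_vector_derivative_vector_3:
  assumes "(a has_real_derivative a') F" "(b has_real_derivative b') F" "(c has_real_derivative c') F"
  shows "((\<lambda>x. vector [a x, b x, c x] :: real^3) has_vector_derivative vector [a', b', c']) F"
  using has_derivative_vector_3[OF assms[unfolded has_field_derivative_def]]
  by (simp add: has_vector_derivative_def vector_3_eq_axis algebra_simps)

section \<open>Mean curvature of the graph\<close>

text \<open>The product rule for a vanishing inner product. Derivatives are taken within
  \<open>S\<close> because a normal field is only known to be differentiable within the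
  surface.\<close>

lemma inner_eq_0_derivative:
  fixes A B :: "real \<Rightarrow> 'a::real_inner"
  assumes "open S" "s \<in> S" "(A has_vector_derivative A') (at s within S)"
    "(B has_vector_derivative B') (at s within S)" "\<And>t. t \<in> S \<Longrightarrow> A t \<bullet> B t = 0"
  shows "A' \<bullet> B s = - (A s \<bullet> B')"
proof -
  have "((\<lambda>t. A t \<bullet> B t) has_vector_derivative A s \<bullet> B' + A' \<bullet> B s) (at s)"
    using bounded_bilinear.has_vector_derivative[OF bounded_bilinear_inner assms(3,4)]
    by (simp add: at_within_open[OF assms(2,1)])
  moreover have "((\<lambda>t. A t \<bullet> B t) has_vector_derivative 0) (at s)"
    by (rule has_vector_derivative_transform_within_open[where f = "\<lambda>_. 0", OF _ assms(1,2)])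
      (simp_all add: assms(5))
  ultimately have "A s \<bullet> B' + A' \<bullet> B s = 0"
    by (rule vector_derivative_unique_at)
  then show ?thesis
    by simp
qed

text \<open>Let C have rows (a1, b1) and (a2, b2), and let S be the Gram matrix with entries E, F,
  G. The hypotheses say C S C^T = 1, so C^T C is the inverse of S; the claims are its entries
  multiplied by det S.\<close>

lemma orthonormal_frame_coordinates:
  fixes E F G :: real
  assumes h1: "a1 * a1 * E + 2 * a1 * b1 * F + b1 * b1 * G = 1"
    and h2: "a2 * a2 * E + 2 * a2 * b2 * F + b2 * b2 * G = 1"
    and h3: "a1 * a2 * E + (a1 * b2 + a2 * b1) * F + b1 * b2 * G = 0"
  shows "(a1 * a1 + a2 * a2) * (E * G - F * F) = G"
    and "(b1 * b1 + b2 * b2) * (E * G - F * F) = E"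
    and "(a1 * b1 + a2 * b2) * (E * G - F * F) = - F"
proof -
  define d where "d = a1 * b2 - a2 * b1"
  have d: "d * d * (E * G - F * F) = 1"
    unfolding d_def using assms by algebra
  \<comment> \<open>Entries of the identity adj C = d S C^T, where \<open>d\<close> is det
    C.\<close>
  have "a1 = d * (a2 * F + b2 * G)" "a2 = - d * (a1 * F + b1 * G)"
    "b1 = - d * (a2 * E + b2 * F)" "b2 = d * (a1 * E + b1 * F)"
    unfolding d_def using assms by algebra+
  then have "a1 * a1 + a2 * a2 = d * d * G" "b1 * b1 + b2 * b2 = d * d * E"
    "a1 * b1 + a2 * b2 = - (d * d * F)"
    using d_def by algebra+
  then show "(a1 * a1 + a2 * a2) * (E * G - F * F) = G"
    "(b1 * b1 + b2 * b2) * (E * G - F * F) = E"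
    "(a1 * b1 + a2 * b2) * (E * G - F * F) = - F"
    using d by algebra+
qed

locale homothetical =
  fixes I J :: "real set" and f g :: "real \<Rightarrow> real"
  assumes open_I: "open I" and open_J: "open J"
    and smooth_f: "smooth_on I f" and smooth_g: "smooth_on J g"
begin

abbreviation "M \<equiv> homothetical_graph I J f g"

abbreviation X :: "real \<Rightarrow> real \<Rightarrow> real^3"
  where "X x y \<equiv> vector [x, y, f x * g y]"

abbreviation X\<^sub>x :: "real \<Rightarrow> real \<Rightarrow> real^3"
  where "X\<^sub>x x y \<equiv> vector [1, 0, deriv f x * g y]"

abbreviation X\<^sub>y :: "real \<Rightarrow> real \<Rightarrow> real^3"
  where "X\<^sub>y x y \<equiv> vector [0, 1, f x * deriv g y]"

lemmas f_deriv = smooth_on_imp_deriv[OF open_I smooth_f]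
lemmas g_deriv = smooth_on_imp_deriv[OF open_J smooth_g]

lemma mem_graph_iff: "p \<in> M \<longleftrightarrow> p $ 1 \<in> I \<and> p $ 2 \<in> J \<and> p $ 3 = f (p $ 1) * g (p $ 2)"
  by (auto simp: homothetical_graph_def vec_eq_iff forall_3)

lemma smooth_on_f_affine:
  assumes "open T" "bounded_linear L" "\<And>t. t \<in> T \<Longrightarrow> x + L t \<in> I"
  shows "smooth_on T (\<lambda>t. f (x + L t))"
  using smooth_f Ck_on_compose_affine[OF open_I assms(2) _ assms(1,3), where f = f]
  by (simp add: smooth_on_def)

lemma smooth_on_g_affine:
  assumes "open T" "bounded_linear L" "\<And>t. t \<in> T \<Longrightarrow> y + L t \<in> J"
  shows "smooth_on T (\<lambda>t. g (y + L t))"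
  using smooth_g Ck_on_compose_affine[OF open_J assms(2) _ assms(1,3), where f = g]
  by (simp add: smooth_on_def)

lemma smooth_on_X_affine:
  assumes T: "open T" and L: "bounded_linear L1" "bounded_linear L2"
    and "\<And>t. t \<in> T \<Longrightarrow> x + L1 t \<in> I" "\<And>t. t \<in> T \<Longrightarrow> y + L2 t \<in> J"
  shows "smooth_on T (\<lambda>t. X (x + L1 t) (y + L2 t))"
proof (rule smooth_on_vector_3[OF T])
  show "smooth_on T (\<lambda>t. f (x + L1 t) * g (y + L2 t))"
    using smooth_on_f_affine[of T L1 x] smooth_on_g_affine[of T L2 y] assms
    by (auto simp: smooth_on_def intro!: Ck_on_mult)
qed (simp_all add: T L smooth_on_def Ck_on_add Ck_on_const Ck_on_linear)

text \<open>Differentiating the equation of the graph along a curve gives the linear relation.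
  Conversely, a vector satisfying it is the velocity of the image under \<open>X\<close> of a
  straight line through (x, y) in the parameter plane.\<close>

lemma tangent_plane_graph:
  assumes x: "x \<in> I" and y: "y \<in> J"
  shows "w \<in> tangent_plane M (X x y) \<longleftrightarrow> w $ 3 = w $ 1 * (deriv f x * g y) + w $ 2 * (f x * deriv g y)"
proof
  assume "w \<in> tangent_plane M (X x y)"
  then obtain \<epsilon> \<gamma> where \<epsilon>: "\<epsilon> > 0" and M: "\<gamma> ` {-\<epsilon><..<\<epsilon>} \<subseteq> M" and \<gamma>0: "\<gamma> 0 = X x y"
    and \<gamma>: "(\<gamma> has_vector_derivative w) (at 0)"
    unfolding tangent_plane_def by auto
  have d: "((\<lambda>t. \<gamma> t $ i) has_real_derivative w $ i) (at 0)" for i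
    using bounded_linear.has_vector_derivative[OF bounded_linear_vec_nth \<gamma>]
    by (simp add: has_real_derivative_iff_has_vector_derivative)
  have "((\<lambda>t. f (\<gamma> t $ 1)) has_real_derivative deriv f x * w $ 1) (at 0)"
    "((\<lambda>t. g (\<gamma> t $ 2)) has_real_derivative deriv g y * w $ 2) (at 0)"
    using DERIV_chain2[of f _ "\<lambda>t. \<gamma> t $ 1", OF _ d] DERIV_chain2[of g _ "\<lambda>t. \<gamma> t $ 2", OF _ d]
      f_deriv(1)[OF x] g_deriv(1)[OF y] by (simp_all add: \<gamma>0)
  then have "((\<lambda>t. f (\<gamma> t $ 1) * g (\<gamma> t $ 2)) has_real_derivative
      w $ 1 * (deriv f x * g y) + w $ 2 * (f x * deriv g y)) (at 0)"
    by (auto intro!: derivative_eq_intros simp: \<gamma>0)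
  moreover have "((\<lambda>t. f (\<gamma> t $ 1) * g (\<gamma> t $ 2)) has_real_derivative w $ 3) (at 0)"
    using has_field_derivative_transform_within_open[OF d, of "{-\<epsilon><..<\<epsilon>}" 3] \<epsilon> M
    by (auto simp: image_subset_iff mem_graph_iff)
  ultimately show "w $ 3 = w $ 1 * (deriv f x * g y) + w $ 2 * (f x * deriv g y)"
    using DERIV_unique by blast
next
  assume w: "w $ 3 = w $ 1 * (deriv f x * g y) + w $ 2 * (f x * deriv g y)"
  \<comment> \<open>The times at which the line stays in the parameter domain; this set is open and
    contains 0, so it contains a symmetric interval.\<close>
  let ?T = "(\<lambda>t. x + t * w $ 1) -` I \<inter> (\<lambda>t. y + t * w $ 2) -` J"
  have "open ?T"
    using open_I open_J by (intro open_Int continuous_open_vimage continuous_intros) auto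
  moreover have "0 \<in> ?T" using x y by simp
  ultimately obtain \<epsilon> where \<epsilon>: "\<epsilon> > 0" "ball 0 \<epsilon> \<subseteq> ?T"
    using open_contains_ball by blast
  have T: "{-\<epsilon><..<\<epsilon>} \<subseteq> ?T"
    using \<epsilon>(2) by (auto simp: ball_def dist_real_def subset_iff)
  let ?\<gamma> = "\<lambda>t. X (x + t * w $ 1) (y + t * w $ 2)"
  have "smooth_on {-\<epsilon><..<\<epsilon>} ?\<gamma>"
    using T by (intro smooth_on_X_affine bounded_linear_mult_left) auto
  moreover have "(?\<gamma> has_vector_derivative vector [w $ 1, w $ 2, w $ 3]) (at 0)"
    using f_deriv(1)[OF x] g_deriv(1)[OF y]
    by (intro has_vector_derivative_vector_3)
      (auto intro!: derivative_eq_intros DERIV_chain2[of f] DERIV_chain2[of g] simp: w)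
  moreover have "vector [w $ 1, w $ 2, w $ 3] = w"
    by (simp add: vec_eq_iff forall_3)
  ultimately show "w \<in> tangent_plane M (X x y)"
    using \<epsilon>(1) T unfolding tangent_plane_def
    by (auto intro!: exI[of _ \<epsilon>] exI[of _ ?\<gamma>] simp: mem_graph_iff subset_iff)
qed

text \<open>Orthogonality to both coordinate tangent vectors makes \<open>N\<close> a multiple of
  the upward direction; the factor \<open>N $ 3\<close> carries the undetermined
  orientation.\<close>

lemma unit_normal_components:
  assumes "unit_normal_field M N" "x \<in> I" "y \<in> J"
  shows "N (X x y) $ 1 = - (N (X x y) $ 3) * (deriv f x * g y)"
    and "N (X x y) $ 2 = - (N (X x y) $ 3) * (f x * deriv g y)"
    and "N (X x y) $ 3 \<noteq> 0"
proof -
  have "N (X x y) \<bullet> X\<^sub>x x y = 0" "N (X x y) \<bullet> X\<^sub>y x y = 0" and 1: "norm (N (X x y)) = 1"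
    using assms by (auto simp: unit_normal_field_def mem_graph_iff tangent_plane_graph)
  then show c: "N (X x y) $ 1 = - (N (X x y) $ 3) * (deriv f x * g y)"
    "N (X x y) $ 2 = - (N (X x y) $ 3) * (f x * deriv g y)"
    by (simp_all add: inner_vector_3)
  show "N (X x y) $ 3 \<noteq> 0"
  proof
    assume "N (X x y) $ 3 = 0"
    then have "N (X x y) = 0" using c by (simp add: vec_eq_iff forall_3)
    then show False using 1 by simp
  qed
qed

lemma second_fundamental_form:
  assumes N: "unit_normal_field M N" and x: "x \<in> I" and y: "y \<in> J"
  defines "A \<equiv> shape_operator M N (X x y)"
  shows "linear A"
    and "A (X\<^sub>x x y) \<bullet> X\<^sub>x x y = N (X x y) $ 3 * (deriv (deriv f) x * g y)"
    and "A (X\<^sub>x x y) \<bullet> X\<^sub>y x y = N (X x y) $ 3 * (deriv f x * deriv g y)"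
    and "A (X\<^sub>y x y) \<bullet> X\<^sub>x x y = N (X x y) $ 3 * (deriv f x * deriv g y)"
    and "A (X\<^sub>y x y) \<bullet> X\<^sub>y x y = N (X x y) $ 3 * (f x * deriv (deriv g) y)"
proof -
  define L where "L = frechet_derivative N (at (X x y) within M)"
  have A: "A w = - L w" for w
    by (simp add: A_def L_def shape_operator_def)
  have L: "(N has_derivative L) (at (X x y) within M)"
    using N x y unfolding L_def
    by (auto simp: unit_normal_field_def differentiable_on_def frechet_derivative_works mem_graph_iff)
  moreover have "A = (\<lambda>w. - L w)"
    using A by blast
  ultimately show "linear A"
    using has_derivative_linear[of N L] linear_compose_neg[of L] by simp
  have *: "N (X s t) \<bullet> X\<^sub>x s t = 0" "N (X s t) \<bullet> X\<^sub>y s t = 0" if "s \<in> I" "t \<in> J" for s t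
    using N that by (auto simp: unit_normal_field_def mem_graph_iff tangent_plane_graph)
  have "((\<lambda>s. X s y) has_vector_derivative X\<^sub>x x y) (at x within I)"
    using has_field_derivative_at_within[OF f_deriv(1)[OF x], of I]
    by (intro has_vector_derivative_vector_3) (auto intro!: derivative_eq_intros)
  \<comment> \<open>The coordinate curve stays in the graph, so the chain rule applies to the
    derivative of \<open>N\<close> within \<open>M\<close>.\<close>
  then have Lx: "((\<lambda>s. N (X s y)) has_vector_derivative L (X\<^sub>x x y)) (at x within I)"
    using vector_derivative_diff_chain_within[of "\<lambda>s. X s y" _ x I N L] y
      has_derivative_subset[OF L, of "(\<lambda>s. X s y) ` I"]
    by (auto simp: o_def mem_graph_iff image_subset_iff)
  have "((\<lambda>t. X x t) has_vector_derivative X\<^sub>y x y) (at y within J)"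
    using has_field_derivative_at_within[OF g_deriv(1)[OF y], of J]
    by (intro has_vector_derivative_vector_3) (auto intro!: derivative_eq_intros)
  then have Ly: "((\<lambda>t. N (X x t)) has_vector_derivative L (X\<^sub>y x y)) (at y within J)"
    using vector_derivative_diff_chain_within[of "\<lambda>t. X x t" _ y J N L] x
      has_derivative_subset[OF L, of "(\<lambda>t. X x t) ` J"]
    by (auto simp: o_def mem_graph_iff image_subset_iff)
  have "((\<lambda>s. X\<^sub>x s y) has_vector_derivative vector [0, 0, deriv (deriv f) x * g y]) (at x within I)"
    using has_field_derivative_at_within[OF f_deriv(2)[OF x], of I]
    by (intro has_vector_derivative_vector_3) (auto intro!: derivative_eq_intros)
  from inner_eq_0_derivative[OF open_I x Lx this] * y
  show "A (X\<^sub>x x y) \<bullet> X\<^sub>x x y = N (X x y) $ 3 * (deriv (deriv f) x * g y)"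
    by (simp add: A) (simp add: inner_vector_3)
  have "((\<lambda>s. X\<^sub>y s y) has_vector_derivative vector [0, 0, deriv f x * deriv g y]) (at x within I)"
    using has_field_derivative_at_within[OF f_deriv(1)[OF x], of I]
    by (intro has_vector_derivative_vector_3) (auto intro!: derivative_eq_intros)
  from inner_eq_0_derivative[OF open_I x Lx this] * y
  show "A (X\<^sub>x x y) \<bullet> X\<^sub>y x y = N (X x y) $ 3 * (deriv f x * deriv g y)"
    by (simp add: A) (simp add: inner_vector_3)
  have "((\<lambda>t. X\<^sub>x x t) has_vector_derivative vector [0, 0, deriv f x * deriv g y]) (at y within J)"
    using has_field_derivative_at_within[OF g_deriv(1)[OF y], of J]
    by (intro has_vector_derivative_vector_3) (auto intro!: derivative_eq_intros)
  from inner_eq_0_derivative[OF open_J y Ly this] * x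
  show "A (X\<^sub>y x y) \<bullet> X\<^sub>x x y = N (X x y) $ 3 * (deriv f x * deriv g y)"
    by (simp add: A) (simp add: inner_vector_3)
  have "((\<lambda>t. X\<^sub>y x t) has_vector_derivative vector [0, 0, f x * deriv (deriv g) y]) (at y within J)"
    using has_field_derivative_at_within[OF g_deriv(2)[OF y], of J]
    by (intro has_vector_derivative_vector_3) (auto intro!: derivative_eq_intros)
  from inner_eq_0_derivative[OF open_J y Ly this] * x
  show "A (X\<^sub>y x y) \<bullet> X\<^sub>y x y = N (X x y) $ 3 * (f x * deriv (deriv g) y)"
    by (simp add: A) (simp add: inner_vector_3)
qed

text \<open>The definite description requires existence and uniqueness: \<open>trace\<close> yields
  the same value for every orthonormal tangent frame, and Gram-Schmidt supplies one such
  frame.\<close>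

lemma mean_curvature_graph:
  assumes N: "unit_normal_field M N" and x: "x \<in> I" and y: "y \<in> J"
  defines "P \<equiv> deriv f x * g y" and "Q \<equiv> f x * deriv g y"
  shows "mean_curvature M N (X x y) = N (X x y) $ 3 *
    ((1 + Q\<^sup>2) * (deriv (deriv f) x * g y) - 2 * P * Q * (deriv f x * deriv g y)
      + (1 + P\<^sup>2) * (f x * deriv (deriv g) y)) / (2 * (1 + P\<^sup>2 + Q\<^sup>2))"
    (is "_ = ?H")
proof -
  define A where "A = shape_operator M N (X x y)"
  define n where "n = N (X x y) $ 3"
  note II = second_fundamental_form[OF N x y, folded A_def n_def]
  define E F G where "E = 1 + P * P" and "F = P * Q" and "G = 1 + Q * Q"
  have W: "E * G - F * F = 1 + P\<^sup>2 + Q\<^sup>2"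
    by (simp add: E_def F_def G_def algebra_simps power2_eq_square)
  have W_pos: "1 + P\<^sup>2 + Q\<^sup>2 > 0" and E_pos: "E > 0"
    by (simp_all add: E_def add_pos_nonneg)
  have T: "w \<in> tangent_plane M (X x y) \<longleftrightarrow> w = w $ 1 *\<^sub>R X\<^sub>x x y + w $ 2 *\<^sub>R X\<^sub>y x y" for w
    by (simp add: tangent_plane_graph[OF x y] vec_eq_iff forall_3)
  have inner: "(a *\<^sub>R X\<^sub>x x y + b *\<^sub>R X\<^sub>y x y) \<bullet> (c *\<^sub>R X\<^sub>x x y + d *\<^sub>R X\<^sub>y x y) =
      a * c * E + (a * d + c * b) * F + b * d * G" for a b c d
    by (simp add: inner_vec_def sum_3 E_def F_def G_def P_def Q_def algebra_simps)
  have AI: "A (a *\<^sub>R X\<^sub>x x y + b *\<^sub>R X\<^sub>y x y) \<bullet> (a *\<^sub>R X\<^sub>x x y + b *\<^sub>R X\<^sub>y x y) =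
      n * (a * a * (deriv (deriv f) x * g y) + 2 * a * b * (deriv f x * deriv g y)
        + b * b * (f x * deriv (deriv g) y))" for a b
    using II(2-5)
    by (simp add: linear_add[OF II(1)] linear_scale[OF II(1)] inner_add_left inner_add_right algebra_simps)
  have trace: "(A e1 \<bullet> e1 + A e2 \<bullet> e2) / 2 = ?H"
    if t: "e1 \<in> tangent_plane M (X x y)" "e2 \<in> tangent_plane M (X x y)"
      and on: "norm e1 = 1" "norm e2 = 1" "e1 \<bullet> e2 = 0" for e1 e2
  proof -
    define a1 b1 a2 b2 where "a1 = e1 $ 1" "b1 = e1 $ 2" "a2 = e2 $ 1" "b2 = e2 $ 2"
    have e: "e1 = a1 *\<^sub>R X\<^sub>x x y + b1 *\<^sub>R X\<^sub>y x y" "e2 = a2 *\<^sub>R X\<^sub>x x y + b2 *\<^sub>R X\<^sub>y x y"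
      using t[unfolded T] by (simp_all only: a1_b1_a2_b2_def)
    have "e1 \<bullet> e1 = 1" "e2 \<bullet> e2 = 1"
      using on by (simp_all add: dot_square_norm)
    then have h: "a1 * a1 * E + 2 * a1 * b1 * F + b1 * b1 * G = 1"
      "a2 * a2 * E + 2 * a2 * b2 * F + b2 * b2 * G = 1"
      "a1 * a2 * E + (a1 * b2 + a2 * b1) * F + b1 * b2 * G = 0"
      using on(3) unfolding e inner by (simp_all add: algebra_simps)
    note c = orthonormal_frame_coordinates[OF h, unfolded W]
    define u v w where "u = deriv (deriv f) x * g y" and "v = deriv f x * deriv g y"
      and "w = f x * deriv (deriv g) y"
    have "(A e1 \<bullet> e1 + A e2 \<bullet> e2) * (1 + P\<^sup>2 + Q\<^sup>2) =
      n * ((a1 * a1 + a2 * a2) * (1 + P\<^sup>2 + Q\<^sup>2) * u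
        + 2 * ((a1 * b1 + a2 * b2) * (1 + P\<^sup>2 + Q\<^sup>2)) * v
        + (b1 * b1 + b2 * b2) * (1 + P\<^sup>2 + Q\<^sup>2) * w)"
      unfolding e AI u_def[symmetric] v_def[symmetric] w_def[symmetric] by (simp add: algebra_simps)
    also have "\<dots> = n * (G * u - 2 * F * v + E * w)"
      unfolding c by simp
    finally have "(A e1 \<bullet> e1 + A e2 \<bullet> e2) / 2 =
        n * (G * u - 2 * F * v + E * w) / (2 * (1 + P\<^sup>2 + Q\<^sup>2))"
      using W_pos by (simp add: field_simps)
    then show ?thesis
      unfolding E_def F_def G_def n_def u_def v_def w_def power2_eq_square by (simp only: mult.assoc)
  qed
  \<comment> \<open>Gram-Schmidt applied to the coordinate tangent vectors: the first is divided by
    sqrt E, and E times the second minus F times the first is divided by sqrt (E (E G -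
    F^2)).\<close>
  define r s where "r = 1 / sqrt E" and "s = 1 / sqrt (1 + P\<^sup>2 + Q\<^sup>2)"
  have r: "r * r * E = 1" and s: "s * s * (E * G - F * F) = 1"
    using E_pos W_pos W by (simp_all add: r_def s_def)
  define e1 where "e1 = r *\<^sub>R X\<^sub>x x y + 0 *\<^sub>R X\<^sub>y x y"
  define e2 where "e2 = (- F * r * s) *\<^sub>R X\<^sub>x x y + (E * r * s) *\<^sub>R X\<^sub>y x y"
  have t: "e1 \<in> tangent_plane M (X x y)" "e2 \<in> tangent_plane M (X x y)"
    by (simp_all add: T e1_def e2_def)
  have "e1 \<bullet> e1 = 1" "e2 \<bullet> e2 = 1" "e1 \<bullet> e2 = 0"
    unfolding e1_def e2_def inner using r s by (algebra, algebra, simp add: algebra_simps)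
  then have on: "norm e1 = 1" "norm e2 = 1" "e1 \<bullet> e2 = 0"
    by (simp_all add: norm_eq_1)
  show ?thesis
    unfolding mean_curvature_def A_def[symmetric]
  proof (rule the_equality)
    show "\<exists>e\<^sub>1\<in>tangent_plane M (X x y). \<exists>e\<^sub>2\<in>tangent_plane M (X x y).
        norm e\<^sub>1 = 1 \<and> norm e\<^sub>2 = 1 \<and> e\<^sub>1 \<bullet> e\<^sub>2 = 0 \<and> ?H = (A e\<^sub>1 \<bullet> e\<^sub>1 + A e\<^sub>2 \<bullet> e\<^sub>2) / 2"
      using trace[OF t on, symmetric] t on by blast
    show "h = ?H" if "\<exists>e\<^sub>1\<in>tangent_plane M (X x y). \<exists>e\<^sub>2\<in>tangent_plane M (X x y).
        norm e\<^sub>1 = 1 \<and> norm e\<^sub>2 = 1 \<and> e\<^sub>1 \<bullet> e\<^sub>2 = 0 \<and> h = (A e\<^sub>1 \<bullet> e\<^sub>1 + A e\<^sub>2 \<bullet> e\<^sub>2) / 2" for h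
      using that trace by blast
  qed
qed

section \<open>The graph as a connected smooth surface with a unit normal\<close>

lemma smooth_on_X: "smooth_on (I \<times> J) (\<lambda>q. X (fst q) (snd q))"
  using smooth_on_X_affine[OF open_Times[OF open_I open_J] bounded_linear_fst bounded_linear_snd, of 0 0]
  by auto

lemma continuous_on_X: "continuous_on (I \<times> J) (\<lambda>q. X (fst q) (snd q))"
  using smooth_on_X Ck_on.simps(1) unfolding smooth_on_def by blast

lemma connected_graph:
  assumes "connected I" "connected J"
  shows "connected M"
proof -
  have "M = (\<lambda>q. X (fst q) (snd q)) ` (I \<times> J)"
    by (force simp: homothetical_graph_def)
  then show ?thesis
    using connected_continuous_image[OF continuous_on_X] connected_Times assms by simp
qed

text \<open>One global chart suffices. Its inverse is the projection to the first two coordinates,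
  and its derivative is injective because those two coordinates are reproduced.\<close>

lemma smooth_surface_graph: "smooth_surface M"
  unfolding smooth_surface_def
proof (intro ballI exI conjI)
  fix p assume "p \<in> M"
  let ?U = "I \<times> J" and ?X = "\<lambda>q. X (fst q) (snd q)" and ?Y = "\<lambda>p::real^3. (p $ 1, p $ 2)"
  show "open (UNIV :: (real^3) set)" "p \<in> UNIV" by auto
  show "open ?U" using open_I open_J by (rule open_Times)
  show "smooth_on ?U ?X"
    by (rule smooth_on_X)
  have "continuous_on ?U ?X"
    by (rule continuous_on_X)
  moreover have "continuous_on (M \<inter> UNIV) ?Y"
    by (intro continuous_intros)
  ultimately show "homeomorphism ?U (M \<inter> UNIV) ?X ?Y"
    by (intro homeomorphismI) (auto simp: mem_graph_iff vec_eq_iff forall_3)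
  show "inj (frechet_derivative ?X (at q))" if "q \<in> ?U" for q
  proof -
    have "fst q \<in> I" "snd q \<in> J" using that by auto
    then have "(f has_derivative (*) (deriv f (fst q))) (at (fst q))"
      "(g has_derivative (*) (deriv g (snd q))) (at (snd q))"
      using f_deriv(1) g_deriv(1) by (auto simp: has_field_derivative_def)
    note has_derivative_compose[OF has_derivative_fst[OF has_derivative_ident] this(1)]
      has_derivative_compose[OF has_derivative_snd[OF has_derivative_ident] this(2)]
    from has_derivative_vector_3[OF has_derivative_fst[OF has_derivative_ident]
        has_derivative_snd[OF has_derivative_ident] has_derivative_mult[OF this]]
    have "frechet_derivative ?X (at q) = (\<lambda>v. vector [fst v, snd v,
        f (fst q) * (deriv g (snd q) * snd v) + deriv f (fst q) * fst v * g (snd q)])"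
      by (intro frechet_derivative_at[symmetric])
    then show ?thesis
      by (auto simp: inj_def vec_eq_iff forall_3 prod_eq_iff)
  qed
qed

text \<open>Only the first two coordinates of \<open>p\<close> enter, so the field extends off the
  graph and can be differentiated in an ordinary neighbourhood of each of its points.\<close>

definition upward_normal :: "real^3 \<Rightarrow> real^3" where
  "upward_normal p =
     (let P = deriv f (p $ 1) * g (p $ 2); Q = f (p $ 1) * deriv g (p $ 2)
      in (1 / sqrt (1 + P\<^sup>2 + Q\<^sup>2)) *\<^sub>R vector [- P, - Q, 1])"

lemma unit_normal_field_upward_normal: "unit_normal_field M upward_normal"
  unfolding unit_normal_field_def
proof (intro conjI ballI)
  have "upward_normal differentiable (at p)" if "p \<in> M" for p
  proof -
    have p: "p $ 1 \<in> I" "p $ 2 \<in> J" using that by (auto simp: mem_graph_iff)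
    have nth: "((\<lambda>p. p $ i) has_derivative (\<lambda>p. p $ i)) (at p)" for i :: 3
      by (rule bounded_linear_imp_has_derivative[OF bounded_linear_vec_nth])
    have comp: "(\<lambda>p. h (p $ i)) differentiable (at p)"
      if "(h has_real_derivative h') (at (p $ i))" for h h' and i :: 3
      using has_derivative_compose[OF nth that[unfolded has_field_derivative_def]]
      by (rule differentiableI)
    have d: "(\<lambda>p. deriv f (p $ 1)) differentiable (at p)" "(\<lambda>p. f (p $ 1)) differentiable (at p)"
      "(\<lambda>p. deriv g (p $ 2)) differentiable (at p)" "(\<lambda>p. g (p $ 2)) differentiable (at p)"
      using f_deriv[OF p(1)] g_deriv[OF p(2)] by (blast intro: comp)+
    have sqrt: "(\<lambda>p. sqrt (h p)) differentiable (at p)"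
      if "h differentiable (at p)" "h p > 0" for h :: "real^3 \<Rightarrow> real"
      using that has_derivative_real_sqrt unfolding differentiable_def by blast
    show ?thesis
      unfolding upward_normal_def[abs_def] Let_def vector_3_eq_axis
      by (intro differentiable_scaleR differentiable_add differentiable_divide differentiable_const
          differentiable_minus differentiable_mult differentiable_power sqrt d)
        (simp_all add: add_pos_nonneg less_imp_neq[symmetric])
  qed
  then show "upward_normal differentiable_on M"
    by (auto simp: differentiable_on_def intro: differentiable_at_withinI)
next
  fix p assume p: "p \<in> M"
  define P Q where "P = deriv f (p $ 1) * g (p $ 2)" and "Q = f (p $ 1) * deriv g (p $ 2)"
  have N: "upward_normal p = (1 / sqrt (1 + P\<^sup>2 + Q\<^sup>2)) *\<^sub>R vector [- P, - Q, 1]"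
    by (simp add: upward_normal_def P_def Q_def Let_def)
  have "norm (vector [- P, - Q, 1] :: real^3) = sqrt (1 + P\<^sup>2 + Q\<^sup>2)"
    by (simp add: norm_eq_sqrt_inner inner_vector_3 power2_eq_square add_ac)
  moreover have "1 + P\<^sup>2 + Q\<^sup>2 > 0"
    by (simp add: add_pos_nonneg)
  ultimately show "norm (upward_normal p) = 1"
    by (simp add: N)
  fix w assume "w \<in> tangent_plane M p"
  moreover have "p = X (p $ 1) (p $ 2)"
    using p by (simp add: mem_graph_iff vec_eq_iff forall_3)
  ultimately have "w \<in> tangent_plane M (X (p $ 1) (p $ 2))" by simp
  then have "w $ 3 = w $ 1 * P + w $ 2 * Q"
    using p by (simp add: tangent_plane_graph mem_graph_iff P_def Q_def)
  then show "upward_normal p \<bullet> w = 0"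
    by (simp add: N inner_commute[of _ w] inner_vector_3)
qed

text \<open>Both sides of the soliton condition carry the nonzero factor \<open>N $ 3\<close>;
  cancelling it removes the choice of \<open>N\<close>. The forward direction extracts the equation
  from the given soliton, and the converse certifies the extended cylinders as solitons.\<close>

theorem translating_soliton_graph_iff:
  "translating_soliton v M \<longleftrightarrow> (\<forall>x\<in>I. \<forall>y\<in>J.
     (1 + (f x * deriv g y)\<^sup>2) * (deriv (deriv f) x * g y)
     - 2 * (deriv f x * g y) * (f x * deriv g y) * (deriv f x * deriv g y)
     + (1 + (deriv f x * g y)\<^sup>2) * (f x * deriv (deriv g) y)
     = 2 * (1 + (deriv f x * g y)\<^sup>2 + (f x * deriv g y)\<^sup>2)
       * (- v $ 1 * (deriv f x * g y) - v $ 2 * (f x * deriv g y) + v $ 3))"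
  (is "_ \<longleftrightarrow> (\<forall>x\<in>I. \<forall>y\<in>J. ?L x y = 2 * ?W x y * ?R x y)")
proof -
  have eq: "mean_curvature M N (X x y) = N (X x y) \<bullet> v \<longleftrightarrow> ?L x y = 2 * ?W x y * ?R x y"
    if N: "unit_normal_field M N" and x: "x \<in> I" and y: "y \<in> J" for N x y
  proof -
    have W: "2 * ?W x y > 0"
      by (simp add: add_pos_nonneg)
    have v: "v = vector [v $ 1, v $ 2, v $ 3]"
      by (simp add: vec_eq_iff forall_3)
    have "N (X x y) \<bullet> v = N (X x y) $ 3 * ?R x y"
      by (subst v) (simp add: inner_vector_3 unit_normal_components(1,2)[OF that] algebra_simps)
    moreover have "mean_curvature M N (X x y) = N (X x y) $ 3 * (?L x y / (2 * ?W x y))"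
      using mean_curvature_graph[OF that] by simp
    ultimately show ?thesis
      using unit_normal_components(3)[OF that] W
      by (simp only: mult_cancel_left divide_eq_eq mult.commute[of "?R x y"]) auto
  qed
  have M: "(\<forall>p\<in>M. \<phi> p) \<longleftrightarrow> (\<forall>x\<in>I. \<forall>y\<in>J. \<phi> (X x y))" for \<phi>
    by (auto simp: homothetical_graph_def)
  show ?thesis
    unfolding translating_soliton_def M
    using smooth_surface_graph unit_normal_field_upward_normal eq by meson
qed

end

section \<open>Separation of variables\<close>

lemma poly_eq_0_if_infinite_roots:
  fixes p :: "real poly"
  assumes "infinite A" "\<And>x. x \<in> A \<Longrightarrow> poly p x = 0"
  shows "p = 0"
  using assms poly_roots_finite[of p] by (metis (mono_tags) mem_Collect_eq rev_finite_subset subsetI)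

lemma has_zero_derivative_if_constant:
  fixes h :: "real \<Rightarrow> real"
  assumes "open S" "x \<in> S" "(h has_real_derivative d) (at x)" "\<And>t. t \<in> S \<Longrightarrow> h t = c"
  shows "d = 0"
proof -
  have "((\<lambda>_. c) has_real_derivative d) (at x)"
    using assms by (auto intro: has_field_derivative_transform_within_open)
  then show ?thesis
    using DERIV_unique[of "\<lambda>_. c" d x 0] by simp
qed

text \<open>A finite connected set has at most one point. This provides the infinitely many
  arguments at which the polynomials below vanish.\<close>

lemma infinite_image_if_not_constant:
  fixes h :: "real \<Rightarrow> real"
  assumes "connected S" "continuous_on S h" "\<nexists>c. \<forall>x\<in>S. h x = c"
  shows "infinite (h ` S)"
  using connected_finite_iff_sing[OF connected_continuous_image[OF assms(2,1)]] assms(3)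
  by (metis imageI empty_iff singletonD)

lemma infinite_image_if_derivative:
  fixes h :: "real \<Rightarrow> real"
  assumes "open S" "connected S" "x \<in> S" "d x \<noteq> 0"
    and "\<And>x. x \<in> S \<Longrightarrow> (h has_real_derivative d x) (at x)"
  shows "infinite (h ` S)"
proof (rule infinite_image_if_not_constant[OF assms(2)])
  show "continuous_on S h"
    using assms(5) by (meson DERIV_isCont continuous_at_imp_continuous_on)
  show "\<nexists>c. \<forall>x\<in>S. h x = c"
    using has_zero_derivative_if_constant[OF assms(1,3) assms(5)[OF assms(3)]] assms(4) by blast
qed

section \<open>Contradictions when both factors are nonconstant\<close>

lemma no_vertical_soliton:
  fixes f f' f'' g g' g'' :: "real \<Rightarrow> real"
  assumes f: "infinite (f ` I)" and g: "infinite (g ` J)"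
    and eq: "\<And>x y. x \<in> I \<Longrightarrow> y \<in> J \<Longrightarrow>
      (1 + (f x * g' y)\<^sup>2) * (f'' x * g y) - 2 * (f' x * g y) * (f x * g' y) * (f' x * g' y)
      + (1 + (f' x * g y)\<^sup>2) * (f x * g'' y) = 2 * (1 + (f' x * g y)\<^sup>2 + (f x * g' y)\<^sup>2)"
  shows False
proof -
  obtain B where "B \<subseteq> g ` J" "finite B" "card B = 3"
    using infinite_arbitrarily_large[OF g] by metis
  then obtain b1 b2 b3 where "{b1, b2, b3} \<subseteq> g ` J" "b1 \<noteq> b2" "b1 \<noteq> b3" "b2 \<noteq> b3"
    using card_3_iff by metis
  then obtain y1 y2 y3 where y: "y1 \<in> J" "y2 \<in> J" "y3 \<in> J"
    "g y1 \<noteq> g y2" "g y1 \<noteq> g y3" "g y2 \<noteq> g y3"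
    by auto
  \<comment> \<open>Polynomials in the value of \<open>f\<close>: in \<open>row\<close>,
    \<open>u\<close> and \<open>v\<close> are the coefficients of f'' and f'^2, and \<open>w\<close>
    is the remaining term.\<close>
  define u where "u y = [:g y, 0, g y * (g' y)\<^sup>2:]" for y
  define v where "v y = [:- 2 * (g y)\<^sup>2, (g y)\<^sup>2 * g'' y - 2 * g y * (g' y)\<^sup>2:]" for y
  define w where "w y = [:2, - g'' y, 2 * (g' y)\<^sup>2:]" for y
  define D where "D = u y1 * (v y2 * w y3 - v y3 * w y2) - u y2 * (v y1 * w y3 - v y3 * w y1)
    + u y3 * (v y1 * w y2 - v y2 * w y1)"
  have row: "poly (u y) (f x) * f'' x + poly (v y) (f x) * (f' x)\<^sup>2 = poly (w y) (f x)"
    if "x \<in> I" "y \<in> J" for x y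
    using eq[OF that] by (simp add: u_def v_def w_def power2_eq_square algebra_simps)
  have "poly D (f x) = 0" if "x \<in> I" for x
    by (simp add: D_def row[OF that y(1), symmetric] row[OF that y(2), symmetric]
        row[OF that y(3), symmetric] algebra_simps)
  then have "D = 0"
    using poly_eq_0_if_infinite_roots[OF f] by auto
  \<comment> \<open>At 0 the rows of the determinant are (g, -2 g^2, 2), so it is -4 times a
    Vandermonde determinant.\<close>
  moreover have "poly D 0 = - 4 * ((g y2 - g y1) * (g y3 - g y1) * (g y3 - g y2))"
    by (simp add: D_def u_def v_def w_def) algebra
  ultimately show False using y by auto
qed

text \<open>The case Q = q0 + q1 t, where \<open>eq0\<close> and \<open>eq1\<close> are the
  coefficients of 1 and t. With h = p / f, \<open>eq1\<close> becomes the autonomous equation h' =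
  -2 h (h^2 + q1) / q1, and \<open>eq0\<close> becomes the relation \<open>alg\<close> between f^2
  and h. Differentiating \<open>alg\<close> leaves a polynomial equation for h alone.\<close>

lemma no_horizontal_soliton_affine:
  fixes f p p' k m K P :: "real \<Rightarrow> real" and q0 q1 :: real
  assumes S: "open S" "connected S" "x0 \<in> S"
    and f: "\<And>x. x \<in> S \<Longrightarrow> (f has_real_derivative p x) (at x)"
    and p: "\<And>x. x \<in> S \<Longrightarrow> (p has_real_derivative p' x) (at x)"
    and nz: "\<And>x. x \<in> S \<Longrightarrow> f x \<noteq> 0" "\<And>x. x \<in> S \<Longrightarrow> p x \<noteq> 0"
    and eq0: "\<And>x. x \<in> S \<Longrightarrow> q1 - 2 * (p x)\<^sup>2 * q0 + f x * (p' x + 2 * p x) * q0 + (p' x + 2 * p x) / f x = 0"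
    and eq1: "\<And>x. x \<in> S \<Longrightarrow> - (p x)\<^sup>2 * q1 + f x * (p' x + 2 * p x) * q1 + 2 * (p x)^3 / f x = 0"
  shows False
proof -
  have q1: "q1 \<noteq> 0" using eq1[OF S(3)] nz[OF S(3)] by auto
  define h where "h x = p x / f x" for x
  have ph: "p x = f x * h x" "h x \<noteq> 0" if "x \<in> S" for x
    using nz[OF that] by (simp_all add: h_def)
  have p'h: "q1 * (p' x + 2 * f x * h x) = f x * (q1 * (h x)\<^sup>2 - 2 * (h x)^3)" if "x \<in> S" for x
  proof -
    have "2 * (p x)^3 / f x = 2 * (f x)\<^sup>2 * (h x)^3"
      using ph[OF that] nz[OF that] by (simp add: power2_eq_square power3_eq_cube)
    then have "f x * (q1 * (p' x + 2 * f x * h x)) = f x * (f x * (q1 * (h x)\<^sup>2 - 2 * (h x)^3))"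
      using eq1[OF that] ph(1)[OF that] by algebra
    then show ?thesis using nz[OF that] by simp
  qed
  define h' where "h' x = - 2 * h x * ((h x)\<^sup>2 + q1) / q1" for x
  have h: "(h has_real_derivative h' x) (at x)" if "x \<in> S" for x
  proof -
    have "(h has_real_derivative (p' x * f x - p x * p x) / (f x * f x)) (at x)"
      unfolding h_def[abs_def] using f[OF that] p[OF that] nz[OF that]
      by (auto intro!: derivative_eq_intros)
    moreover have "(p' x * f x - p x * p x) * q1 = (- 2 * h x * ((h x)\<^sup>2 + q1)) * (f x * f x)"
      using p'h[OF that] ph(1)[OF that] by algebra
    then have "(p' x * f x - p x * p x) / (f x * f x) = h' x"
      unfolding h'_def using nz[OF that] q1 by (subst frac_eq_eq) auto
    ultimately show ?thesis by simp
  qed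
  have cont_h: "continuous_on S h"
    using h by (meson DERIV_isCont continuous_at_imp_continuous_on)
  define D where "D z = q1 * z\<^sup>2 + 2 * z^3" for z :: real
  define N where "N z = q1\<^sup>2 + q1 * z\<^sup>2 - 2 * z^3" for z :: real
  have alg: "(f x)\<^sup>2 * q0 * D (h x) = N (h x)" if "x \<in> S" for x
  proof -
    have "(p' x + 2 * p x) / f x * q1 = q1 * (h x)\<^sup>2 - 2 * (h x)^3"
      using p'h[OF that] ph(1)[OF that] nz[OF that] by (simp add: field_simps)
    then show ?thesis
      using eq0[OF that] p'h[OF that] ph(1)[OF that] unfolding D_def N_def by algebra
  qed
  show False
  proof (cases "\<exists>c. \<forall>x\<in>S. h x = c")
    case True
    then obtain c where c: "\<And>x. x \<in> S \<Longrightarrow> h x = c" by blast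
    \<comment> \<open>A constant h is a nonzero equilibrium, so c^2 = - q1 and N c = -2 c^3. Then
      f^2 would be constant, although its derivative 2 f p does not vanish.\<close>
    have "h' x0 = 0"
      using has_zero_derivative_if_constant[OF S(1,3) h[OF S(3)] c] .
    then have "c\<^sup>2 = - q1" "c \<noteq> 0"
      using ph(2)[OF S(3)] c[OF S(3)] q1 by (auto simp: h'_def)
    then have "N c \<noteq> 0" unfolding N_def by (simp add: power2_eq_square)
    moreover have fc: "(f x)\<^sup>2 * (q0 * D c) = N c" if "x \<in> S" for x
      using alg[OF that] c[OF that] by (simp add: mult.assoc)
    ultimately have "q0 * D c \<noteq> 0"
      using S(3) by force
    then have "(f x)\<^sup>2 = N c / (q0 * D c)" if "x \<in> S" for x
      using fc[OF that] nonzero_eq_divide_eq by blast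
    moreover have "((\<lambda>x. (f x)\<^sup>2) has_real_derivative 2 * f x0 * p x0) (at x0)"
      using f[OF S(3)] by (auto intro!: derivative_eq_intros)
    ultimately have "2 * f x0 * p x0 = 0"
      using has_zero_derivative_if_constant[OF S(1,3)] by blast
    then show False using nz[OF S(3)] by simp
  next
    case False
    then have inf: "infinite (h ` S)"
      using infinite_image_if_not_constant[OF S(2) cont_h] by blast
    \<comment> \<open>Differentiate \<open>alg\<close>, multiply by \<open>D (h x)\<close> to eliminate \<open>f x\<close>, insert \<open>h'\<close> and cancel \<open>2 * h x\<close>.\<close>
    have "poly [:0, - 2 * q1^4, q1^4 - 6 * q1^3, 0, q1^3 - 10 * q1\<^sup>2, 0, - 8 * q1:] (h x) = 0"
      if x: "x \<in> S" for x
    proof -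
      have "((\<lambda>x. (f x)\<^sup>2 * q0 * D (h x) - N (h x)) has_real_derivative
          2 * f x * p x * q0 * D (h x) + (f x)\<^sup>2 * q0 * ((2 * q1 * h x + 6 * (h x)\<^sup>2) * h' x)
          - (2 * q1 * h x - 6 * (h x)\<^sup>2) * h' x) (at x)"
        unfolding D_def N_def using f[OF x] h[OF x]
        by (auto intro!: derivative_eq_intros simp: algebra_simps power2_eq_square power3_eq_cube)
      from has_zero_derivative_if_constant[OF S(1) x this, of 0] alg
      have "2 * f x * p x * q0 * D (h x) + (f x)\<^sup>2 * q0 * ((2 * q1 * h x + 6 * (h x)\<^sup>2) * h' x)
          - (2 * q1 * h x - 6 * (h x)\<^sup>2) * h' x = 0"
        by simp
      moreover have "q1 * h' x = - 2 * h x * ((h x)\<^sup>2 + q1)"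
        using q1 by (simp add: h'_def)
      ultimately have "2 * h x * (q1 * N (h x) * D (h x)
          - ((h x)\<^sup>2 + q1) * (N (h x) * (2 * q1 * h x + 6 * (h x)\<^sup>2) - (2 * q1 * h x - 6 * (h x)\<^sup>2) * D (h x))) = 0"
        using alg[OF x] ph(1)[OF x] by algebra
      then have "q1 * N (h x) * D (h x)
          - ((h x)\<^sup>2 + q1) * (N (h x) * (2 * q1 * h x + 6 * (h x)\<^sup>2) - (2 * q1 * h x - 6 * (h x)\<^sup>2) * D (h x)) = 0"
        using ph(2)[OF x] by simp
      then show ?thesis
        unfolding D_def N_def by simp algebra
    qed
    then have "[:0, - 2 * q1^4, q1^4 - 6 * q1^3, 0, q1^3 - 10 * q1\<^sup>2, 0, - 8 * q1:] = 0"
      using poly_eq_0_if_infinite_roots[OF inf] by blast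
    \<comment> \<open>The leading coefficient -8 q1 is nonzero.\<close>
    then show False using q1 by simp
  qed
qed

text \<open>The case where k, P and K are affine in m = p^2. Since f P = 2 p^3 and k = f^2 K,
  eliminating f gives a polynomial in m, which takes infinitely many values. Its low coefficients
  and one more differentiation leave only P = P1 m, which means that f is exponential.\<close>

lemma no_horizontal_soliton_nonaffine:
  fixes f p p' :: "real \<Rightarrow> real" and k0 k1 P0 P1 K0 K1 :: real
  assumes S: "open S" "connected S" "x0 \<in> S"
    and f: "\<And>x. x \<in> S \<Longrightarrow> (f has_real_derivative p x) (at x)"
    and p: "\<And>x. x \<in> S \<Longrightarrow> (p has_real_derivative p' x) (at x)"
    and nz: "\<And>x. x \<in> S \<Longrightarrow> f x \<noteq> 0" "\<And>x. x \<in> S \<Longrightarrow> p x \<noteq> 0"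
    and k: "\<And>x. x \<in> S \<Longrightarrow> f x * (p' x + 2 * p x) = k0 + k1 * (p x)\<^sup>2"
    and P: "\<And>x. x \<in> S \<Longrightarrow> 2 * (p x)^3 / f x = P0 + P1 * (p x)\<^sup>2"
    and K: "\<And>x. x \<in> S \<Longrightarrow> (p' x + 2 * p x) / f x = K0 + K1 * (p x)\<^sup>2"
  shows "\<exists>l. l \<noteq> 0 \<and> (\<forall>x\<in>S. p x = l * f x \<and> p' x = l * p x)"
proof -
  have m': "((\<lambda>x. (p x)\<^sup>2) has_real_derivative 2 * p x * p' x) (at x)" if "x \<in> S" for x
    using p[OF that] by (auto intro!: derivative_eq_intros)
  \<comment> \<open>If p^2 were constant, then p' = 0 and 2 f p would be constant, but its
    derivative 2 p^2 does not vanish.\<close>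
  have "\<nexists>c. \<forall>x\<in>S. (p x)\<^sup>2 = c"
  proof
    assume "\<exists>c. \<forall>x\<in>S. (p x)\<^sup>2 = c"
    then obtain c where c: "\<And>x. x \<in> S \<Longrightarrow> (p x)\<^sup>2 = c" by blast
    have p'0: "p' x = 0" if "x \<in> S" for x
      using has_zero_derivative_if_constant[OF S(1) that m'[OF that] c] nz[OF that] by simp
    then have "f x * (2 * p x) = k0 + k1 * c" if "x \<in> S" for x
      using k[OF that] c[OF that] that by simp
    moreover have "((\<lambda>x. f x * (2 * p x)) has_real_derivative 2 * (p x0)\<^sup>2) (at x0)"
      using f[OF S(3)] p[OF S(3)] p'0[OF S(3)] by (auto intro!: derivative_eq_intros simp: power2_eq_square)
    ultimately have "2 * (p x0)\<^sup>2 = 0"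
      using has_zero_derivative_if_constant[OF S(1,3)] by blast
    then show False using nz[OF S(3)] by simp
  qed
  moreover have "continuous_on S (\<lambda>x. (p x)\<^sup>2)"
    using m' by (meson DERIV_isCont continuous_at_imp_continuous_on)
  ultimately have inf: "infinite ((\<lambda>x. (p x)\<^sup>2) ` S)"
    using infinite_image_if_not_constant[OF S(2)] by blast
  have fP: "f x * (P0 + P1 * (p x)\<^sup>2) = 2 * (p x)^3" if "x \<in> S" for x
    using P[OF that] nz[OF that] by (simp add: field_simps)
  \<comment> \<open>Eliminate \<open>f x\<close> between \<open>fP\<close> and \<open>k x = (f x)\<^sup>2 * K x\<close>.\<close>
  have "poly [:P0\<^sup>2 * k0, P0\<^sup>2 * k1 + 2 * P0 * P1 * k0, P1\<^sup>2 * k0 + 2 * P0 * P1 * k1,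
      P1\<^sup>2 * k1 - 4 * K0, - 4 * K1:] ((p x)\<^sup>2) = 0" if x: "x \<in> S" for x
  proof -
    have "p' x + 2 * p x = (K0 + K1 * (p x)\<^sup>2) * f x"
      using K[OF x] nz[OF x] by (simp add: divide_eq_eq)
    with k[OF x] fP[OF x] have "(P0 + P1 * (p x)\<^sup>2)\<^sup>2 * (k0 + k1 * (p x)\<^sup>2) = 4 * (p x)^6 * (K0 + K1 * (p x)\<^sup>2)"
      by algebra
    then show ?thesis by simp algebra
  qed
  then have "[:P0\<^sup>2 * k0, P0\<^sup>2 * k1 + 2 * P0 * P1 * k0, P1\<^sup>2 * k0 + 2 * P0 * P1 * k1,
      P1\<^sup>2 * k1 - 4 * K0, - 4 * K1:] = 0"
    using poly_eq_0_if_infinite_roots[OF inf] by blast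
  then have coeffs: "P0\<^sup>2 * k0 = 0" "P0\<^sup>2 * k1 + 2 * P0 * P1 * k0 = 0" "P1\<^sup>2 * k0 + 2 * P0 * P1 * k1 = 0"
    by simp_all
  \<comment> \<open>Otherwise k = 0 and hence p' = -2 p; differentiating \<open>fP\<close> then
    produces a vanishing polynomial in p^2 whose constant coefficient is P0^2.\<close>
  have "P0 = 0"
  proof (rule ccontr)
    assume "P0 \<noteq> 0"
    then have "k0 = 0" "k1 = 0" using coeffs by auto
    then have p'2: "p' x = - 2 * p x" if "x \<in> S" for x
      using k[OF that] nz[OF that] by simp
    have "poly [:P0\<^sup>2, 2 * P0 * P1 + 12 * P0, P1\<^sup>2 + 4 * P1:] ((p x)\<^sup>2) = 0" if x: "x \<in> S" for x
    proof -
      have "((\<lambda>x. f x * (P0 + P1 * (p x)\<^sup>2) - 2 * (p x)^3) has_real_derivative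
        p x * (P0 + P1 * (p x)\<^sup>2) + f x * (P1 * (2 * p x * p' x)) - 6 * (p x)\<^sup>2 * p' x) (at x)"
        using f[OF x] p[OF x] by (auto intro!: derivative_eq_intros simp: algebra_simps)
      from has_zero_derivative_if_constant[OF S(1) x this, of 0] fP
      have "p x * (P0 + P1 * (p x)\<^sup>2) + f x * (P1 * (2 * p x * p' x)) - 6 * (p x)\<^sup>2 * p' x = 0"
        by simp
      then have "p x * (P0 + P1 * (p x)\<^sup>2 - 4 * P1 * f x * p x + 12 * (p x)\<^sup>2) = 0"
        using p'2[OF x] by algebra
      then have "P0 + P1 * (p x)\<^sup>2 - 4 * P1 * f x * p x + 12 * (p x)\<^sup>2 = 0"
        using nz[OF x] by simp
      then show ?thesis using fP[OF x] by simp algebra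
    qed
    then have "[:P0\<^sup>2, 2 * P0 * P1 + 12 * P0, P1\<^sup>2 + 4 * P1:] = 0"
      using poly_eq_0_if_infinite_roots[OF inf] by blast
    then show False using \<open>P0 \<noteq> 0\<close> by simp
  qed
  have pf: "p x = P1 / 2 * f x" if "x \<in> S" for x
  proof -
    have "(p x)\<^sup>2 * (f x * P1) = (p x)\<^sup>2 * (2 * p x)"
      using fP[OF that] \<open>P0 = 0\<close> by (simp add: power2_eq_square power3_eq_cube)
    then show ?thesis using nz[OF that] by (simp add: mult.commute)
  qed
  show ?thesis
  proof (intro exI conjI ballI)
    show "P1 / 2 \<noteq> 0" using pf[OF S(3)] nz[OF S(3)] by auto
    fix x assume x: "x \<in> S"
    show "p x = P1 / 2 * f x" by (rule pf[OF x])
    have "((\<lambda>x. p x - P1 / 2 * f x) has_real_derivative p' x - P1 / 2 * p x) (at x)"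
      using f[OF x] p[OF x] by (auto intro!: derivative_eq_intros)
    from has_zero_derivative_if_constant[OF S(1) x this, of 0] pf
    show "p' x = P1 / 2 * p x" by simp
  qed
qed

lemma no_horizontal_soliton_local:
  fixes f p p' g q r :: "real \<Rightarrow> real"
  assumes S: "open S" "connected S" "x0 \<in> S" and T: "open T" "connected T" "y0 \<in> T"
    and f: "\<And>x. x \<in> S \<Longrightarrow> (f has_real_derivative p x) (at x)"
    and p: "\<And>x. x \<in> S \<Longrightarrow> (p has_real_derivative p' x) (at x)"
    and g: "\<And>y. y \<in> T \<Longrightarrow> (g has_real_derivative q y) (at y)"
    and q: "\<And>y. y \<in> T \<Longrightarrow> (q has_real_derivative r y) (at y)"
    and nz: "\<And>x. x \<in> S \<Longrightarrow> f x \<noteq> 0" "\<And>x. x \<in> S \<Longrightarrow> p x \<noteq> 0"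
      "\<And>y. y \<in> T \<Longrightarrow> g y \<noteq> 0" "\<And>y. y \<in> T \<Longrightarrow> q y \<noteq> 0"
    and eq: "\<And>x y. x \<in> S \<Longrightarrow> y \<in> T \<Longrightarrow>
      (1 + (f x * q y)\<^sup>2) * (p' x * g y) - 2 * (p x * g y) * (f x * q y) * (p x * q y)
      + (1 + (p x * g y)\<^sup>2) * (f x * r y) = - (2 * (1 + (p x * g y)\<^sup>2 + (f x * q y)\<^sup>2) * (p x * g y))"
  shows False
proof -
  define m k P K where "m x = (p x)\<^sup>2" and "k x = f x * (p' x + 2 * p x)"
    and "P x = 2 * (p x)^3 / f x" and "K x = (p' x + 2 * p x) / f x" for x
  define t Q \<rho> where "t y = (g y)\<^sup>2" and "Q y = (q y)\<^sup>2" and "\<rho> y = r y / g y" for y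
  have eq': "\<rho> y + m x * (t y * \<rho> y - 2 * Q y) + k x * Q y + P x * t y + K x = 0"
    if "x \<in> S" "y \<in> T" for x y
  proof -
    have "r y = \<rho> y * g y" "P x * f x = 2 * (p x)^3" "K x * f x = p' x + 2 * p x"
      using that nz by (simp_all add: \<rho>_def P_def K_def)
    then have "f x * (g y * (\<rho> y + m x * (t y * \<rho> y - 2 * Q y) + k x * Q y + P x * t y + K x)) = 0"
      using eq[OF that] unfolding m_def k_def t_def Q_def by algebra
    then show ?thesis using that nz by simp
  qed
  have "infinite (t ` T)"
    unfolding t_def using nz(3,4) T(3) g
    by (intro infinite_image_if_derivative[OF T, where d = "\<lambda>y. 2 * g y * q y"])
      (auto intro!: derivative_eq_intros)
  then obtain B where "B \<subseteq> t ` T" "finite B" "card B = 2"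
    using infinite_arbitrarily_large by metis
  then obtain b1 b2 where "{b1, b2} \<subseteq> t ` T" "b1 \<noteq> b2"
    using card_2_iff by metis
  then obtain y1 y2 where y: "y1 \<in> T" "y2 \<in> T" "t y1 \<noteq> t y2"
    by auto
  have affine: False if aff: "\<And>y. y \<in> T \<Longrightarrow> Q y = q0 + q1 * t y" for q0 q1
  proof -
    have \<rho>: "\<rho> y = q1" if "y \<in> T" for y
    proof -
      have "((\<lambda>y. (q y)\<^sup>2 - (q0 + q1 * (g y)\<^sup>2)) has_real_derivative
          2 * q y * r y - q1 * (2 * g y * q y)) (at y)"
        using g[OF that] q[OF that] by (auto intro!: derivative_eq_intros)
      from has_zero_derivative_if_constant[OF T(1) that this, of 0] aff
      have "q y * (r y - q1 * g y) = 0" by (simp add: Q_def t_def algebra_simps)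
      then show ?thesis using nz that by (simp add: \<rho>_def)
    qed
    have *: "(q1 - 2 * m x * q0 + k x * q0 + K x) + (- m x * q1 + k x * q1 + P x) * t y = 0"
      if "x \<in> S" "y \<in> T" for x y
      using eq'[OF that] unfolding \<rho>[OF that(2)] aff[OF that(2)] by (simp add: algebra_simps)
    \<comment> \<open>For fixed x, \<open>*\<close> is affine in t with coefficients independent of
      y; two distinct values of t make both coefficients vanish.\<close>
    have 1: "- m x * q1 + k x * q1 + P x = 0" if "x \<in> S" for x
    proof -
      have "(- m x * q1 + k x * q1 + P x) * (t y1 - t y2) = 0"
        using *[OF that y(1)] *[OF that y(2)] by algebra
      then show ?thesis using y(3) by simp
    qed
    then have 0: "q1 - 2 * m x * q0 + k x * q0 + K x = 0" if "x \<in> S" for x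
      using *[OF that y(1)] that by simp
    show False
      by (rule no_horizontal_soliton_affine[OF S f p nz(1,2)
            0[unfolded m_def k_def K_def] 1[unfolded m_def k_def P_def]])
  qed
  \<comment> \<open>The line interpolating Q as a function of t at \<open>y1\<close> and
    \<open>y2\<close>. Since Q is not affine in t, some \<open>y3\<close> lies off it, and the three
    linear equations for k, P, K become independent.\<close>
  define q1 where "q1 = (Q y1 - Q y2) / (t y1 - t y2)"
  define q0 where "q0 = Q y1 - q1 * t y1"
  obtain y3 where y3: "y3 \<in> T" "Q y3 \<noteq> q0 + q1 * t y3"
    using affine by blast
  define aff where "aff \<phi> \<longleftrightarrow> (\<exists>c0 c1. \<forall>x\<in>S. \<phi> x = c0 + c1 * m x)" for \<phi> :: "real \<Rightarrow> real"
  have aff_lin: "aff (\<lambda>x. c * \<phi> x + d * \<psi> x)" if \<phi>: "aff \<phi>" and \<psi>: "aff \<psi>" for \<phi> \<psi> c d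
  proof -
    obtain a0 a1 where "\<forall>x\<in>S. \<phi> x = a0 + a1 * m x"
      using \<phi> unfolding aff_def by blast
    moreover obtain b0 b1 where "\<forall>x\<in>S. \<psi> x = b0 + b1 * m x"
      using \<psi> unfolding aff_def by blast
    ultimately have "\<forall>x\<in>S. c * \<phi> x + d * \<psi> x = (c * a0 + d * b0) + (c * a1 + d * b1) * m x"
      by (simp add: algebra_simps)
    then show ?thesis unfolding aff_def by blast
  qed
  have aff_cong: "aff \<psi>" if "aff \<phi>" "\<And>x. x \<in> S \<Longrightarrow> \<phi> x = \<psi> x" for \<phi> \<psi>
    using that unfolding aff_def by auto
  define R where "R y x = - \<rho> y - m x * (t y * \<rho> y - 2 * Q y)" for y x
  have R: "aff (R y)" for y
  proof -
    have "\<forall>x\<in>S. R y x = - \<rho> y + (2 * Q y - t y * \<rho> y) * m x"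
      by (simp add: R_def algebra_simps)
    then show ?thesis unfolding aff_def by blast
  qed
  have row: "k x * Q y + P x * t y + K x = R y x" if "x \<in> S" "y \<in> T" for x y
    using eq'[OF that] by (simp add: R_def)
  define e where "e = Q y3 - q0 - q1 * t y3"
  \<comment> \<open>The barycentric weight placing t y3 between t y1 and t y2. The matching
    combination of the three rows eliminates P and K and leaves k times \<open>e\<close>.\<close>
  define w where "w = (t y3 - t y2) / (t y1 - t y2)"
  have e: "e \<noteq> 0" using y3 by (simp add: e_def)
  have w: "w * (t y1 - t y2) = t y3 - t y2" and q1: "q1 * (t y1 - t y2) = Q y1 - Q y2"
    using y(3) by (simp_all add: w_def q1_def)
  have barycentric: "w * t y1 + (1 - w) * t y2 = t y3" "w * Q y1 + (1 - w) * Q y2 = q0 + q1 * t y3"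
    using w q1 unfolding q0_def by algebra+
  have "aff k"
  proof (rule aff_cong)
    show "aff (\<lambda>x. (1 / e) * R y3 x + (- 1 / e) * (w * R y1 x + (1 - w) * R y2 x))"
      by (intro aff_lin R)
    fix x assume x: "x \<in> S"
    have "R y3 x - (w * R y1 x + (1 - w) * R y2 x) =
        k x * (Q y3 - (w * Q y1 + (1 - w) * Q y2)) + P x * (t y3 - (w * t y1 + (1 - w) * t y2))"
      by (simp add: row[OF x y(1), symmetric] row[OF x y(2), symmetric] row[OF x y3(1), symmetric]
          algebra_simps)
    also have "\<dots> = k x * e"
      unfolding barycentric by (simp add: e_def)
    finally have "R y3 x - (w * R y1 x + (1 - w) * R y2 x) = k x * e" .
    then show "(1 / e) * R y3 x + (- 1 / e) * (w * R y1 x + (1 - w) * R y2 x) = k x"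
      using e by (simp add: field_simps)
  qed
  have "aff P"
  proof (rule aff_cong)
    let ?d = "t y1 - t y2"
    show "aff (\<lambda>x. (1 / ?d) * (1 * R y1 x + (- 1) * R y2 x) + (- q1) * k x)"
      using \<open>aff k\<close> R by (intro aff_lin)
    fix x assume x: "x \<in> S"
    have "R y1 x - R y2 x = (P x + q1 * k x) * ?d"
    proof -
      have "R y1 x - R y2 x = k x * (Q y1 - Q y2) + P x * ?d"
        by (simp add: row[OF x y(1), symmetric] row[OF x y(2), symmetric] algebra_simps)
      then show ?thesis
        unfolding q1[symmetric] by (simp add: algebra_simps)
    qed
    then show "(1 / ?d) * (1 * R y1 x + (- 1) * R y2 x) + (- q1) * k x = P x"
      using y(3) by simp
  qed
  have "aff K"
  proof (rule aff_cong)
    show "aff (\<lambda>x. 1 * R y1 x + (- 1) * (Q y1 * k x + t y1 * P x))"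
      using \<open>aff k\<close> \<open>aff P\<close> R by (intro aff_lin)
    show "1 * R y1 x + (- 1) * (Q y1 * k x + t y1 * P x) = K x" if "x \<in> S" for x
      using row[OF that y(1)] by (simp add: algebra_simps)
  qed
  obtain k0 k1 where k: "\<And>x. x \<in> S \<Longrightarrow> k x = k0 + k1 * m x"
    using \<open>aff k\<close> unfolding aff_def by blast
  obtain P0 P1 where P: "\<And>x. x \<in> S \<Longrightarrow> P x = P0 + P1 * m x"
    using \<open>aff P\<close> unfolding aff_def by blast
  obtain K0 K1 where K: "\<And>x. x \<in> S \<Longrightarrow> K x = K0 + K1 * m x"
    using \<open>aff K\<close> unfolding aff_def by blast
  obtain l where l: "l \<noteq> 0" "\<And>x. x \<in> S \<Longrightarrow> p x = l * f x" "\<And>x. x \<in> S \<Longrightarrow> p' x = l * p x"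
    using no_horizontal_soliton_nonaffine[OF S f p nz(1,2) k[unfolded k_def m_def]
        P[unfolded P_def m_def] K[unfolded K_def m_def]]
    by blast
  have "infinite ((\<lambda>x. (f x)\<^sup>2) ` S)"
    using nz(1,2) S(3) f
    by (intro infinite_image_if_derivative[OF S, where d = "\<lambda>x. 2 * f x * p x"])
      (auto intro!: derivative_eq_intros)
  then obtain B where "B \<subseteq> (\<lambda>x. (f x)\<^sup>2) ` S" "finite B" "card B = 2"
    using infinite_arbitrarily_large by metis
  then obtain b1 b2 where "{b1, b2} \<subseteq> (\<lambda>x. (f x)\<^sup>2) ` S" "b1 \<noteq> b2"
    using card_2_iff by metis
  then obtain x1 x2 where x: "x1 \<in> S" "x2 \<in> S" "(f x1)\<^sup>2 \<noteq> (f x2)\<^sup>2"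
    by auto
  \<comment> \<open>With f' = l f the equation is affine in f^2 for each y. Two distinct values of
    f^2 give u = 0 and rho = - l (l + 2), which together make Q proportional to t unless l =
    2.\<close>
  have Q: "(2 - l) * Q y = l^3 * t y" if "y \<in> T" for y
  proof -
    define u where "u = l * (t y * \<rho> y - 2 * Q y) + (l + 2) * Q y + 2 * l\<^sup>2 * t y"
    have *: "(\<rho> y + l * (l + 2)) + l * (f x)\<^sup>2 * u = 0" if "x \<in> S" for x
    proof -
      have "P x = 2 * l^3 * (f x)\<^sup>2" "K x = l * (l + 2)" "k x = l * (l + 2) * (f x)\<^sup>2"
        "m x = l\<^sup>2 * (f x)\<^sup>2"
        using l(2,3)[OF that] nz(1)[OF that]
        by (simp_all add: P_def K_def k_def m_def field_simps power2_eq_square power3_eq_cube)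
      then show ?thesis
        using eq'[OF that \<open>y \<in> T\<close>] unfolding u_def by algebra
    qed
    have "l * u * ((f x1)\<^sup>2 - (f x2)\<^sup>2) = 0"
      using *[OF x(1)] *[OF x(2)] by algebra
    then have "u = 0" using l(1) x(3) by simp
    moreover from this have "\<rho> y = - l * (l + 2)" using *[OF x(1)] by simp
    ultimately show ?thesis unfolding u_def by algebra
  qed
  show False
  proof (cases "l = 2")
    case True
    then show False using Q[OF y(1)] y(1) nz by (simp add: t_def)
  next
    case False
    then have "Q y = 0 + l^3 / (2 - l) * t y" if "y \<in> T" for y
      using Q[OF that] by (simp add: field_simps)
    then show False by (rule affine)
  qed
qed

text \<open>By continuity \<open>p\<close> is nonzero near \<open>x0\<close>. There \<open>f\<close>
  cannot vanish identically, so the neighbourhood can be shrunk around a point where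
  \<open>f\<close> is nonzero too.\<close>

lemma eventually_nonzero_and_derivative_nonzero:
  fixes f p :: "real \<Rightarrow> real"
  assumes "open I" "x0 \<in> I" "p x0 \<noteq> 0" "isCont p x0"
    and f: "\<And>x. x \<in> I \<Longrightarrow> (f has_real_derivative p x) (at x)"
  obtains S x1 where "open S" "connected S" "x1 \<in> S" "S \<subseteq> I" "\<And>x. x \<in> S \<Longrightarrow> f x \<noteq> 0 \<and> p x \<noteq> 0"
proof -
  have "\<forall>\<^sub>F x in nhds x0. p x \<noteq> 0 \<and> x \<in> I"
    using assms by (auto simp: eventually_conj_iff isCont_def tendsto_at_iff_tendsto_nhds
        intro: tendsto_imp_eventually_ne eventually_nhds_in_open)
  then obtain U where U: "open U" "x0 \<in> U" "\<And>x. x \<in> U \<Longrightarrow> p x \<noteq> 0 \<and> x \<in> I"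
    unfolding eventually_nhds by blast
  obtain x1 where x1: "x1 \<in> U" "f x1 \<noteq> 0"
    using has_zero_derivative_if_constant[OF U(1,2) f[OF assms(2)], of 0] assms(3) by blast
  have "isCont f x1" using f U(3) x1(1) DERIV_isCont by blast
  then have "\<forall>\<^sub>F x in nhds x1. f x \<noteq> 0 \<and> x \<in> U"
    using x1 U(1) by (auto simp: eventually_conj_iff isCont_def tendsto_at_iff_tendsto_nhds
        intro: tendsto_imp_eventually_ne eventually_nhds_in_open)
  then obtain d where d: "d > 0" "\<And>x. dist x x1 < d \<Longrightarrow> f x \<noteq> 0 \<and> x \<in> U"
    unfolding eventually_nhds_metric by blast
  show thesis
    by (rule that[of "ball x1 d" x1]) (use d U in \<open>auto simp: dist_commute\<close>)
qed

lemma no_horizontal_soliton: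
  fixes f p p' g q r :: "real \<Rightarrow> real"
  assumes I: "open I" "x0 \<in> I" "p x0 \<noteq> 0" and J: "open J" "y0 \<in> J" "q y0 \<noteq> 0"
    and f: "\<And>x. x \<in> I \<Longrightarrow> (f has_real_derivative p x) (at x)"
    and p: "\<And>x. x \<in> I \<Longrightarrow> (p has_real_derivative p' x) (at x)"
    and g: "\<And>y. y \<in> J \<Longrightarrow> (g has_real_derivative q y) (at y)"
    and q: "\<And>y. y \<in> J \<Longrightarrow> (q has_real_derivative r y) (at y)"
    and eq: "\<And>x y. x \<in> I \<Longrightarrow> y \<in> J \<Longrightarrow>
      (1 + (f x * q y)\<^sup>2) * (p' x * g y) - 2 * (p x * g y) * (f x * q y) * (p x * q y)
      + (1 + (p x * g y)\<^sup>2) * (f x * r y) = - (2 * (1 + (p x * g y)\<^sup>2 + (f x * q y)\<^sup>2) * (p x * g y))"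
  shows False
proof -
  obtain S x1 where S: "open S" "connected S" "x1 \<in> S" "S \<subseteq> I" "\<And>x. x \<in> S \<Longrightarrow> f x \<noteq> 0 \<and> p x \<noteq> 0"
    using eventually_nonzero_and_derivative_nonzero[of I x0 p f] I DERIV_isCont[OF p] f by blast
  obtain T y1 where T: "open T" "connected T" "y1 \<in> T" "T \<subseteq> J" "\<And>y. y \<in> T \<Longrightarrow> g y \<noteq> 0 \<and> q y \<noteq> 0"
    using eventually_nonzero_and_derivative_nonzero[of J y0 q g] J DERIV_isCont[OF q] g by blast
  show False
  proof (rule no_horizontal_soliton_local[OF S(1-3) T(1-3)])
    show "(1 + (f x * q y)\<^sup>2) * (p' x * g y) - 2 * (p x * g y) * (f x * q y) * (p x * q y)
      + (1 + (p x * g y)\<^sup>2) * (f x * r y) = - (2 * (1 + (p x * g y)\<^sup>2 + (f x * q y)\<^sup>2) * (p x * g y))"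
      if "x \<in> S" "y \<in> T" for x y
      using eq that S(4) T(4) by blast
  qed (use S T in \<open>auto intro: f p g q\<close>)
qed

section \<open>Cylinders\<close>

text \<open>Closure under translation by t and by -t gives the two inclusions.\<close>

lemma cylindricalI:
  assumes "w \<noteq> 0" "\<And>p t. p \<in> M \<Longrightarrow> p + t *\<^sub>R w \<in> M"
  shows "cylindrical M"
  unfolding cylindrical_def
proof (intro exI[of _ w] conjI allI)
  fix t
  have "p \<in> (\<lambda>p. p + t *\<^sub>R w) ` M" if "p \<in> M" for p
    using assms(2)[OF that, of "- t"] by (intro image_eqI[of _ _ "p - t *\<^sub>R w"]) simp_all
  then show "(\<lambda>p. p + t *\<^sub>R w) ` M = M"
    using assms(2) by auto
qed (rule assms(1))

lemma plane_or_grim_reaper: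
  assumes "translating_soliton v G" "connected G" "cylindrical G" "M \<subseteq> G"
  shows "(\<exists>P. is_plane P \<and> M \<subseteq> P) \<or> (\<exists>G. grim_reaper v G \<and> M \<subseteq> G)"
  using assms unfolding grim_reaper_def by (metis subset_trans)

section \<open>Classification\<close>

context homothetical begin

lemma deriv_f_or_deriv_g_eq_0:
  assumes v: "v \<in> {vector [1, 0, 0], vector [0, 1, 0], vector [0, 0, 1]}"
    and "connected I" "connected J" and M: "translating_soliton v M"
  shows "(\<forall>x\<in>I. deriv f x = 0) \<or> (\<forall>y\<in>J. deriv g y = 0)"
proof (rule ccontr)
  assume "\<not> ?thesis"
  then obtain x0 y0 where x0: "x0 \<in> I" "deriv f x0 \<noteq> 0" and y0: "y0 \<in> J" "deriv g y0 \<noteq> 0"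
    by blast
  note eq = M[unfolded translating_soliton_graph_iff, rule_format]
  consider "v = vector [1, 0, 0]" | "v = vector [0, 1, 0]" | "v = vector [0, 0, 1]"
    using v by blast
  then show False
  proof cases
    case 1
    have *: "(1 + (f x * deriv g y)\<^sup>2) * (deriv (deriv f) x * g y)
        - 2 * (deriv f x * g y) * (f x * deriv g y) * (deriv f x * deriv g y)
        + (1 + (deriv f x * g y)\<^sup>2) * (f x * deriv (deriv g) y)
        = - (2 * (1 + (deriv f x * g y)\<^sup>2 + (f x * deriv g y)\<^sup>2) * (deriv f x * g y))"
      if "x \<in> I" "y \<in> J" for x y
      using eq[OF that] unfolding 1 vector_3 by algebra
    show False
      by (rule no_horizontal_soliton[OF open_I x0 open_J y0 f_deriv g_deriv *])
  next
    case 2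
    \<comment> \<open>Exchanging the two variables reduces this direction to the previous
      case.\<close>
    have *: "(1 + (g y * deriv f x)\<^sup>2) * (deriv (deriv g) y * f x)
        - 2 * (deriv g y * f x) * (g y * deriv f x) * (deriv g y * deriv f x)
        + (1 + (deriv g y * f x)\<^sup>2) * (g y * deriv (deriv f) x)
        = - (2 * (1 + (deriv g y * f x)\<^sup>2 + (g y * deriv f x)\<^sup>2) * (deriv g y * f x))"
      if "y \<in> J" "x \<in> I" for y x
      using eq[OF that(2,1)] unfolding 2 vector_3 by algebra
    show False
      by (rule no_horizontal_soliton[OF open_J y0 open_I x0 g_deriv f_deriv *])
  next
    case 3
    have *: "(1 + (f x * deriv g y)\<^sup>2) * (deriv (deriv f) x * g y)
        - 2 * (deriv f x * g y) * (f x * deriv g y) * (deriv f x * deriv g y)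
        + (1 + (deriv f x * g y)\<^sup>2) * (f x * deriv (deriv g) y)
        = 2 * (1 + (deriv f x * g y)\<^sup>2 + (f x * deriv g y)\<^sup>2)"
      if "x \<in> I" "y \<in> J" for x y
      using eq[OF that] unfolding 3 vector_3 by algebra
    have "infinite (f ` I)"
      by (rule infinite_image_if_derivative[where h = f, OF open_I \<open>connected I\<close> x0 f_deriv(1)])
    moreover have "infinite (g ` J)"
      by (rule infinite_image_if_derivative[where h = g, OF open_J \<open>connected J\<close> y0 g_deriv(1)])
    ultimately show False
      by (rule no_vertical_soliton[OF _ _ *])
  qed
qed

end

theorem theorem3:
  fixes v :: "real^3" and I J :: "real set" and f g :: "real \<Rightarrow> real"
  assumes "v \<in> {vector [1, 0, 0], vector [0, 1, 0], vector [0, 0, 1]}"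
    and "open I" and "is_interval I" and "I \<noteq> {}"
    and "open J" and "is_interval J" and "J \<noteq> {}"
    and "smooth_on I f" and "smooth_on J g"
    and "translating_soliton v (homothetical_graph I J f g)"
  shows "(\<exists>P. is_plane P \<and> homothetical_graph I J f g \<subseteq> P) \<or>
         (\<exists>G. grim_reaper v G \<and> homothetical_graph I J f g \<subseteq> G)"
proof -
  interpret homothetical I J f g
    using assms by unfold_locales
  have conn: "connected I" "connected J"
    using assms by (simp_all add: is_interval_connected)
  have eq: "(1 + (f x * deriv g y)\<^sup>2) * (deriv (deriv f) x * g y)
     - 2 * (deriv f x * g y) * (f x * deriv g y) * (deriv f x * deriv g y)
     + (1 + (deriv f x * g y)\<^sup>2) * (f x * deriv (deriv g) y)
     = 2 * (1 + (deriv f x * g y)\<^sup>2 + (f x * deriv g y)\<^sup>2)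
       * (- v $ 1 * (deriv f x * g y) - v $ 2 * (f x * deriv g y) + v $ 3)"
    if "x \<in> I" "y \<in> J" for x y
    using assms(10) that translating_soliton_graph_iff by blast
  have const: "smooth_on UNIV (\<lambda>_. c)" for c :: real
    by (simp add: smooth_on_def Ck_on_const)
  obtain x0 y0 where x0: "x0 \<in> I" and y0: "y0 \<in> J"
    using assms by blast
  from deriv_f_or_deriv_g_eq_0[OF assms(1) conn assms(10)] show ?thesis
  proof
    assume f': "\<forall>x\<in>I. deriv f x = 0"
    have "(f has_derivative (\<lambda>_. 0)) (at x)" if "x \<in> I" for x
      using f_deriv(1)[OF that] f' that by (simp add: has_field_derivative_def lambda_zero)
    then have f: "f x = f x0" if "x \<in> I" for x
      by (rule has_derivative_zero_unique_connected[OF open_I conn(1) _ that x0])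
    have f'': "deriv (deriv f) x0 = 0"
      using has_zero_derivative_if_constant[OF open_I x0 f_deriv(2)[OF x0]] f' by blast
    \<comment> \<open>Extending the constant factor to the whole line makes the rulings parallel to
      the x-axis complete.\<close>
    interpret G: homothetical UNIV J "\<lambda>_. f x0" g
      by unfold_locales (simp_all add: assms const)
    show ?thesis
    proof (rule plane_or_grim_reaper)
      \<comment> \<open>The equation of the extended graph is independent of x and coincides with
        that of the original graph at \<open>x0\<close>.\<close>
      show "translating_soliton v G.M"
        unfolding G.translating_soliton_graph_iff using eq[OF x0] f' f'' x0 by simp
      show "connected G.M"
        by (rule G.connected_graph) (simp_all add: conn)
      show "cylindrical G.M"
        by (rule cylindricalI[of "vector [1, 0, 0]"])
          (simp_all add: G.mem_graph_iff vec_eq_iff forall_3)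
      show "M \<subseteq> G.M"
        using f by (auto simp: mem_graph_iff G.mem_graph_iff)
    qed
  next
    assume g': "\<forall>y\<in>J. deriv g y = 0"
    have "(g has_derivative (\<lambda>_. 0)) (at y)" if "y \<in> J" for y
      using g_deriv(1)[OF that] g' that by (simp add: has_field_derivative_def lambda_zero)
    then have g: "g y = g y0" if "y \<in> J" for y
      by (rule has_derivative_zero_unique_connected[OF open_J conn(2) _ that y0])
    have g'': "deriv (deriv g) y0 = 0"
      using has_zero_derivative_if_constant[OF open_J y0 g_deriv(2)[OF y0]] g' by blast
    interpret G: homothetical I UNIV f "\<lambda>_. g y0"
      by unfold_locales (simp_all add: assms const)
    show ?thesis
    proof (rule plane_or_grim_reaper)
      show "translating_soliton v G.M"
        unfolding G.translating_soliton_graph_iff using eq[OF _ y0] g' g'' y0 by simp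
      show "connected G.M"
        by (rule G.connected_graph) (simp_all add: conn)
      show "cylindrical G.M"
        by (rule cylindricalI[of "vector [0, 1, 0]"])
          (simp_all add: G.mem_graph_iff vec_eq_iff forall_3)
      show "M \<subseteq> G.M"
        using g by (auto simp: mem_graph_iff G.mem_graph_iff)
    qed
  qed
qed

end
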